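(* Let $A$, $B$ be finite-dimensional quantum systems with dimensions $|A|,|B|$, let $\mathcal{Y}$ be a finite outcome set with $|Y|:=|\mathcal{Y}|$, and let $k\ge 2$ be an integer. Let $\{P^y_{AB}\}_{y\in\mathcal{Y}}$ be an arbitrary $k$-extendible POVM. Then there exists a POVM $\{\Lambda^y_{AB}\}_{y\in\mathcal{Y}}\in \operatorname{1WL}$ such that for every $y\in\mathcal{Y}$, $$\left\Vert P^y_{AB}-\Lambda^y_{AB}\right\Vert_1\le |B|^3|Y|^2\left(|B||Y|+1\right)\sqrt{\frac{2\ln 2\,|A|^3}{k}}.$$ In particular, for fixed $|A|,|B|,|Y|$, the set of $k$-extendible POVMs converges to $\operatorname{1WL}$ as $k\to\infty$.
   Context: A POVM $\{P^y_{AB}\}_{y\in\mathcal{Y}}$ is in $\operatorname{1WL}$ (realizable by local operations and one-way classical communication) if $P^y_{AB}=\sum_{x\in\mathcal{X}}E^x_A\otimes F^{x,y}_B$ for some finite set $\mathcal{X}$, a POVM $\{E^x_A\}_{x\in\mathcal{X}}$, and POVMs $\{F^{x,y}_B\}_{y\in\mathcal{Y}}$ for each $x\in\mathcal{X}$. For an integer $k\ge2$, a bipartite POVM $\{P^y_{AB}\}_{y\in\mathcal{Y}}$ is $k$-extendible if there is a POVM $\{G^{y_1^k}_{AB_1^k}\}_{y_1^k\in\mathcal{Y}^k}$ on $A B_1\cdots B_k$ (each $B_i\cong B$; $y_i^j:=(y_i,\dots,y_j)$, $B_i^j:=B_i\cdots B_j$) such that: (i) $\sum_{y_2^k}G^{y_1^k}_{AB_1^k}=P^{y_1}_{AB_1}\otimes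 I_{B_2^k}$ for all $y_1$; (ii) $\sum_{y_k}\operatorname{Tr}_A[G^{y_1^k}_{AB_1^k}]=\frac{1}{|B|}\sum_{y_k}\operatorname{Tr}_{AB_k}[G^{y_1^k}_{AB_1^k}]\otimes I_{B_k}$ for all $y_1^{k-1}\in\mathcal{Y}^{k-1}$; (iii) $W^\pi_{B_1^k}G^{(y_{\pi(1)},\dots,y_{\pi(k)})}_{AB_1^k}(W^\pi_{B_1^k})^\dagger=G^{y_1^k}_{AB_1^k}$ for all $y_1^k$ and all $\pi\in S_k$, where $W^\pi_{B_1^k}$ is the unitary permuting the systems $B_1,\dots,B_k$ according to $\pi$. $\|\cdot\|_1$ is the trace norm. *)

theory Defs
  imports "Jordan_Normal_Form.Char_Poly" "HOL-Combinatorics.Permutations"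
begin

(* Conventions: a system of dimension d has basis indexed by {0..<d}.
   Operators are complex JNF matrices. The composite system C^m (x) C^n has
   basis index i = a*n + b (a < m, b < n), i.e. the Kronecker ordering.
   For B_1 ... B_k (each of dimension dB) the index is
   b_1*dB^(k-1) + ... + b_k (B_1 most significant). *)

definition adj :: "complex mat \<Rightarrow> complex mat" where
  "adj M = mat (dim_col M) (dim_row M) (\<lambda>(i,j). cnj (M $$ (j,i)))"

definition kron :: "complex mat \<Rightarrow> complex mat \<Rightarrow> complex mat" where
  "kron M N = mat (dim_row M * dim_row N) (dim_col M * dim_col N)
     (\<lambda>(i,j). M $$ (i div dim_row N, j div dim_col N) * N $$ (i mod dim_row N, j mod dim_col N))"

definition ptrace_left :: "nat \<Rightarrow> nat \<Rightarrow> complex mat \<Rightarrow> complex mat" where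
  "ptrace_left m n M = mat n n (\<lambda>(i,j). \<Sum>a<m. M $$ (a*n+i, a*n+j))"

definition ptrace_right :: "nat \<Rightarrow> nat \<Rightarrow> complex mat \<Rightarrow> complex mat" where
  "ptrace_right m n M = mat m m (\<lambda>(i,j). \<Sum>b<n. M $$ (i*n+b, j*n+b))"

definition msum :: "nat \<Rightarrow> 'i set \<Rightarrow> ('i \<Rightarrow> complex mat) \<Rightarrow> complex mat" where
  "msum n S f = mat n n (\<lambda>(i,j). \<Sum>s\<in>S. f s $$ (i,j))"

definition psd :: "nat \<Rightarrow> complex mat \<Rightarrow> bool" where
  "psd n M \<longleftrightarrow> M \<in> carrier_mat n n \<and>
     (\<forall>v :: complex vec. v \<in> carrier_vec n \<longrightarrow>
        (let q = (\<Sum>i<n. \<Sum>j<n. cnj (v $ i) * M $$ (i,j) * v $ j) in Im q = 0 \<and> Re q \<ge> 0))"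

definition is_povm :: "nat \<Rightarrow> 'i set \<Rightarrow> ('i \<Rightarrow> complex mat) \<Rightarrow> bool" where
  "is_povm n S M \<longleftrightarrow> finite S \<and> (\<forall>s\<in>S. psd n (M s)) \<and> msum n S M = 1\<^sub>m n"

text \<open>Trace norm ||X||_1 = Tr sqrt(X^dagger X) = sum of singular values, i.e. the sum of
  the square roots of the eigenvalues (with multiplicity) of X^dagger X.\<close>
definition trace_norm :: "complex mat \<Rightarrow> real" where
  "trace_norm X = (\<Sum>\<^sub># (image_mset (\<lambda>z. sqrt (Re z)) (proots (char_poly (adj X * X)))))"

definition one_WL :: "nat \<Rightarrow> nat \<Rightarrow> ('y::finite \<Rightarrow> complex mat) \<Rightarrow> bool" where
  "one_WL dA dB P \<longleftrightarrow>
     (\<exists>(X :: nat set) E F. is_povm dA X E \<and> (\<forall>x\<in>X. is_povm dB UNIV (F x)) \<and>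
        (\<forall>y. P y = msum (dA*dB) X (\<lambda>x. kron (E x) (F x y))))"

text \<open>i-th digit (0-based, i < k, digit 0 = system B_1) of a basis index of (C^d)^(x) k.\<close>
definition digit :: "nat \<Rightarrow> nat \<Rightarrow> nat \<Rightarrow> nat \<Rightarrow> nat" where
  "digit d k x i = (x div d ^ (k - 1 - i)) mod d"

text \<open>Unitary W^pi on B_1...B_k permuting the systems according to pi (0-based):
  W |b_1...b_k> = |c_1...c_k> with c_(pi i) = b_i.\<close>
definition perm_op :: "nat \<Rightarrow> nat \<Rightarrow> (nat \<Rightarrow> nat) \<Rightarrow> complex mat" where
  "perm_op d k \<pi> = mat (d^k) (d^k)
     (\<lambda>(c,b). if (\<forall>i<k. digit d k b i = digit d k c (\<pi> i)) then 1 else 0)"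

definition k_extendible :: "nat \<Rightarrow> nat \<Rightarrow> nat \<Rightarrow> ('y::finite \<Rightarrow> complex mat) \<Rightarrow> bool" where
  "k_extendible dA dB k P \<longleftrightarrow>
    (\<exists>G :: 'y list \<Rightarrow> complex mat.
       is_povm (dA * dB^k) {ys. length ys = k} G \<and>
       (\<forall>y1. msum (dA * dB^k) {zs. length zs = k - 1} (\<lambda>zs. G (y1 # zs))
              = kron (P y1) (1\<^sub>m (dB^(k-1)))) \<and>
       (\<forall>ys. length ys = k - 1 \<longrightarrow>
          (let S = msum (dA * dB^k) UNIV (\<lambda>y. G (ys @ [y])) in
             ptrace_left dA (dB^k) S =
             (1 / of_nat dB) \<cdot>\<^sub>m kron (ptrace_left dA (dB^(k-1)) (ptrace_right (dA * dB^(k-1)) dB S))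
                                    (1\<^sub>m dB))) \<and>
       (\<forall>ys \<pi>. length ys = k \<longrightarrow> \<pi> permutes {..<k} \<longrightarrow>
          kron (1\<^sub>m dA) (perm_op dB k \<pi>) * G (map (\<lambda>i. ys ! \<pi> i) [0..<k])
            * adj (kron (1\<^sub>m dA) (perm_op dB k \<pi>)) = G ys))"

end

theory Submission
  imports Defs "Jordan_Normal_Form.Schur_Decomposition" "HOL-Analysis.L2_Norm"
begin

text \<open>
  Feed \<open>B\<^sub>1, \<dots>, B\<^sub>k\<close> of the extension with independent random pure probe states that are
  tomographically complete, and record for each system the probe \<open>z\<close> and the outcome \<open>y\<close>. The records
  \<open>l\<close> of \<open>m\<close> systems form a POVM \<open>{h\<^sub>l}\<close> on \<open>A\<close>, and the normalised operators \<open>h\<^sub>l / Tr h\<^sub>l\<close> are a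
  martingale in \<open>m\<close>. Its squared Hilbert-Schmidt norm is at most 1, so among \<open>k\<close> steps one has mean
  square increment at most \<open>1 / k\<close>; this replaces the chain rule for mutual information and Pinsker's
  inequality. At such an \<open>m\<close>, given the record \<open>l\<close>, the probe and outcome of a further system are almost
  independent of \<open>A\<close>, hence the operators on \<open>A B\<close> conditioned on \<open>l\<close> are close to
  \<open>h\<^sub>l \<otimes> F\<^sub>l\<^sub>,\<^sub>y\<close> by inverting the tomography. Condition (ii) says that \<open>{F\<^sub>l\<^sub>,\<^sub>y}\<^sub>y\<close> is a POVM, and
  condition (i) that the conditioned operators sum to \<open>P\<^sup>y\<close>. Of the permutation symmetry only
  cyclic shifts are needed.
\<close>

section \<open>The trace norm and the Hilbert-Schmidt norm\<close>

lemma mult_mat_entry: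
  fixes A B :: "complex mat"
  assumes "A \<in> carrier_mat n n" "B \<in> carrier_mat n n" "i < n" "j < n"
  shows "(A * B) $$ (i,j) = (\<Sum>l<n. A $$ (i,l) * B $$ (l,j))"
  using assms by (auto simp: scalar_prod_def atLeast0LessThan intro!: sum.cong)

lemma trace_mult_commute:
  fixes A B :: "complex mat"
  assumes "A \<in> carrier_mat n n" "B \<in> carrier_mat n n"
  shows "(\<Sum>i<n. (A * B) $$ (i,i)) = (\<Sum>i<n. (B * A) $$ (i,i))"
proof -
  have "(\<Sum>i<n. (A * B) $$ (i,i)) = (\<Sum>i<n. \<Sum>j<n. A $$ (i,j) * B $$ (j,i))"
    using assms by (intro sum.cong refl mult_mat_entry) auto
  also have "\<dots> = (\<Sum>j<n. \<Sum>i<n. B $$ (j,i) * A $$ (i,j))"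
    by (subst sum.swap) (simp add: mult.commute)
  also have "\<dots> = (\<Sum>j<n. (B * A) $$ (j,j))"
    using assms by (intro sum.cong refl mult_mat_entry[symmetric]) auto
  finally show ?thesis .
qed

text \<open>Schur triangularisation \<open>M = P * B * Q\<close> with \<open>Q * P = 1\<close> puts
  the eigenvalues on the diagonal of \<open>B\<close>, and the trace is cyclic.\<close>

lemma sum_eigenvalues_eq_trace:
  fixes M :: "complex mat"
  assumes M: "M \<in> carrier_mat n n" and cp: "char_poly M = (\<Prod>a\<leftarrow>as. [:- a, 1:])"
  shows "sum_list as = (\<Sum>i<n. M $$ (i,i))"
proof -
  obtain B P Q where schur: "schur_decomposition M as = (B,P,Q)"
    by (cases "schur_decomposition M as") auto
  from schur_decomposition[OF M cp schur]
  have sim: "similar_mat_wit M B P Q" and diag: "diag_mat B = as" by auto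
  note s = similar_mat_witD2[OF M sim]
  have "(\<Sum>i<n. M $$ (i,i)) = (\<Sum>i<n. (Q * (P * B)) $$ (i,i))"
    unfolding s(3) using s(4-7) by (intro trace_mult_commute) auto
  also have "Q * (P * B) = B"
    using s by (metis assoc_mult_mat left_mult_one_mat)
  also have "(\<Sum>i<n. B $$ (i,i)) = sum_list as"
    using s(5) by (simp add: diag[symmetric] diag_mat_def interv_sum_list_conv_sum_set_nat atLeast0LessThan)
  finally show ?thesis by simp
qed

lemma gram_entry:
  assumes "X \<in> carrier_mat n n" "i < n" "j < n"
  shows "(adj X * X) $$ (i,j) = (\<Sum>l<n. cnj (X $$ (l,i)) * X $$ (l,j))"
  using assms by (auto simp: adj_def scalar_prod_def atLeast0LessThan intro!: sum.cong)

text \<open>For an eigenvector \<open>v\<close>, \<open>a\<close> times the squared norm of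
  \<open>v\<close> is the squared norm of \<open>X v\<close>, called \<open>w\<close> below. So
  \<open>trace_norm\<close> takes roots of nonnegative reals.\<close>

lemma gram_eigenvalue_nonneg:
  assumes X: "X \<in> carrier_mat n n" and ev: "eigenvalue (adj X * X) a"
  shows "Re a \<ge> 0"
proof -
  have aX: "adj X \<in> carrier_mat n n" using X by (simp add: adj_def)
  from ev obtain v where "eigenvector (adj X * X) v a" unfolding eigenvalue_def by auto
  then have v: "v \<in> carrier_vec n" "v \<noteq> 0\<^sub>v n" and e: "(adj X * X) *\<^sub>v v = a \<cdot>\<^sub>v v"
    using aX unfolding eigenvector_def by auto
  define w where "w l = (\<Sum>j<n. X $$ (l,j) * v $ j)" for l
  have row: "a * v $ i = (\<Sum>l<n. cnj (X $$ (l,i)) * w l)" if i: "i < n" for i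
  proof -
    have "a * v $ i = ((adj X * X) *\<^sub>v v) $ i" using e i v by simp
    also have "\<dots> = (\<Sum>j<n. (adj X * X) $$ (i,j) * v $ j)"
      using X aX i v by (auto simp: mult_mat_vec_def scalar_prod_def atLeast0LessThan intro!: sum.cong)
    also have "\<dots> = (\<Sum>j<n. \<Sum>l<n. cnj (X $$ (l,i)) * X $$ (l,j) * v $ j)"
      using X i by (simp add: gram_entry sum_distrib_right del: index_mult_mat)
    also have "\<dots> = (\<Sum>l<n. cnj (X $$ (l,i)) * w l)"
      by (subst sum.swap) (simp add: w_def sum_distrib_left mult.assoc)
    finally show ?thesis .
  qed
  have "a * (\<Sum>i<n. cnj (v $ i) * v $ i) = (\<Sum>i<n. cnj (v $ i) * (a * v $ i))"
    by (simp add: sum_distrib_left mult_ac)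
  also have "\<dots> = (\<Sum>i<n. cnj (v $ i) * (\<Sum>l<n. cnj (X $$ (l,i)) * w l))"
    using row by simp
  also have "\<dots> = (\<Sum>l<n. cnj (w l) * w l)"
  proof -
    have "cnj (w l) * w l = (\<Sum>i<n. cnj (v $ i) * (cnj (X $$ (l,i)) * w l))" for l
      by (subst (1) w_def) (simp add: sum_distrib_left mult_ac)
    then show ?thesis by (simp add: sum_distrib_left) (rule sum.swap)
  qed
  finally have eq: "a * (\<Sum>i<n. cnj (v $ i) * v $ i) = (\<Sum>l<n. cnj (w l) * w l)" .
  have cn: "cnj z * z = complex_of_real ((cmod z)\<^sup>2)" for z
    by (metis complex_norm_square mult.commute)
  have "a * complex_of_real (\<Sum>i<n. (cmod (v $ i))\<^sup>2) = complex_of_real (\<Sum>l<n. (cmod (w l))\<^sup>2)"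
    using eq by (simp only: cn of_real_sum)
  then have re: "Re a * (\<Sum>i<n. (cmod (v $ i))\<^sup>2) = (\<Sum>l<n. (cmod (w l))\<^sup>2)"
    by (simp add: complex_eq_iff del: of_real_sum)
  have norm_pos: "(\<Sum>i<n. (cmod (v $ i))\<^sup>2) > 0"
  proof -
    obtain i where "i < n" "v $ i \<noteq> 0" using v by (metis carrier_vecD eq_vecI index_zero_vec(1) index_zero_vec(2))
    then show ?thesis by (intro sum_pos2[of _ i]) auto
  qed
  have "Re a * (\<Sum>i<n. (cmod (v $ i))\<^sup>2) \<ge> 0" unfolding re by (simp add: sum_nonneg)
  with norm_pos show ?thesis by (simp add: zero_le_mult_iff)
qed

text \<open>Cauchy-Schwarz against the constant vector 1.\<close>

lemma sum_list_sqrt_le: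
  assumes "\<And>x. x \<in> set xs \<Longrightarrow> x \<ge> (0::real)"
  shows "(\<Sum>x\<leftarrow>xs. sqrt x) \<le> sqrt (real (length xs)) * sqrt (sum_list xs)"
proof -
  let ?I = "{..<length xs}"
  have "(\<Sum>x\<leftarrow>xs. sqrt x) = (\<Sum>i\<in>?I. \<bar>1\<bar> * \<bar>sqrt (xs ! i)\<bar>)"
    using assms by (simp add: sum_list_sum_nth atLeast0LessThan)
  also have "\<dots> \<le> L2_set (\<lambda>_. 1) ?I * L2_set (\<lambda>i. sqrt (xs ! i)) ?I"
    by (rule L2_set_mult_ineq)
  also have "\<dots> = sqrt (real (length xs)) * sqrt (sum_list xs)"
    using assms by (simp add: L2_set_def sum_list_sum_nth atLeast0LessThan)
  finally show ?thesis .
qed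

text \<open>Cauchy-Schwarz over the \<open>n\<close> singular values, whose squares add up to the
  trace of \<open>adj X * X\<close>, the squared Hilbert-Schmidt norm. This costs a factor
  \<open>sqrt (|A| |B|)\<close> in the final bound.\<close>

lemma trace_norm_le_hilbert_schmidt:
  assumes X: "X \<in> carrier_mat n n"
  shows "trace_norm X \<le> sqrt (real n) * L2_set (\<lambda>(i,j). cmod (X $$ (i,j))) ({..<n} \<times> {..<n})"
proof -
  let ?M = "adj X * X"
  have M: "?M \<in> carrier_mat n n" using X by (auto simp: adj_def)
  obtain as where cp: "char_poly ?M = (\<Prod>a\<leftarrow>as. [:- a, 1:])" and len: "length as = n"
    using char_poly_factorized[OF M] by blast
  have roots: "proots (char_poly ?M) = mset as"
    unfolding cp
  proof (induction as)
    case (Cons a as)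
    have "(\<Prod>a\<leftarrow>as. [:- a, 1:]) \<noteq> 0" by (auto simp: prod_list_zero_iff)
    then have "proots ([:- a, 1:] * (\<Prod>a\<leftarrow>as. [:- a, 1:])) = {#a#} + mset as"
      using Cons proots_mult[of "[:- a, 1:]" "\<Prod>a\<leftarrow>as. [:- a, 1:]"] by simp
    then show ?case by (simp del: mult_pCons_left)
  qed simp
  have nonneg: "Re a \<ge> 0" if "a \<in> set as" for a
    using that gram_eigenvalue_nonneg[OF X, of a] eigenvalue_root_char_poly[OF M, of a]
    by (auto simp: cp poly_prod_list prod_list_zero_iff)
  have "trace_norm X = (\<Sum>x\<leftarrow>map Re as. sqrt x)"
    unfolding trace_norm_def roots by (simp add: o_def flip: sum_mset_sum_list)
  also have "\<dots> \<le> sqrt (real n) * sqrt (sum_list (map Re as))"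
    using sum_list_sqrt_le[of "map Re as"] nonneg len by auto
  also have "sum_list (map Re as) = Re (sum_list as)" by (induction as) auto
  also have "\<dots> = Re (\<Sum>i<n. \<Sum>l<n. cnj (X $$ (l,i)) * X $$ (l,i))"
    unfolding sum_eigenvalues_eq_trace[OF M cp] using gram_entry[OF X] by simp
  also have "\<dots> = (\<Sum>i<n. \<Sum>l<n. (cmod (X $$ (l,i)))\<^sup>2)"
    by (simp add: cmod_power2 flip: power2_eq_square)
  also have "\<dots> = (\<Sum>(i,j)\<in>{..<n} \<times> {..<n}. (cmod (X $$ (i,j)))\<^sup>2)"
    by (subst sum.swap) (simp add: sum.cartesian_product)
  finally show ?thesis by (simp add: L2_set_def case_prod_unfold)
qed

section \<open>A step of a martingale with small increment\<close>

definition words :: "'s set \<Rightarrow> nat \<Rightarrow> 's list set" where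
  "words S m = {l. length l = m \<and> set l \<subseteq> S}"

lemma words_0 [simp]: "words S 0 = {[]}"
  by (auto simp: words_def)

lemma finite_words [simp]: "finite S \<Longrightarrow> finite (words S m)"
  unfolding words_def using finite_lists_length_eq[of S m] by (simp add: conj_commute)

lemma Cons_words: "s \<in> S \<Longrightarrow> l \<in> words S m \<Longrightarrow> s # l \<in> words S (Suc m)"
  by (auto simp: words_def)

lemma sum_words_append:
  "(\<Sum>l\<in>words S (m + n). f l) = (\<Sum>l\<in>words S m. \<Sum>l'\<in>words S n. f (l @ l'))"
proof -
  have "(\<Sum>l\<in>words S (m + n). f l) = (\<Sum>(l,l')\<in>words S m \<times> words S n. f (l @ l'))"
    by (rule sum.reindex_bij_witness[where i = "\<lambda>(l,l'). l @ l'" and j = "\<lambda>l. (take m l, drop m l)"])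
       (auto simp: words_def dest: in_set_takeD in_set_dropD)
  then show ?thesis by (simp add: sum.cartesian_product)
qed

lemma sum_words_Suc0: "(\<Sum>l\<in>words S (Suc 0). f l) = (\<Sum>s\<in>S. f [s])"
  by (rule sum.reindex_bij_witness[where i = "\<lambda>s. [s]" and j = hd])
     (auto simp: words_def length_Suc_conv)

lemma sum_words_Cons:
  "(\<Sum>l\<in>words S (Suc m). f l) = (\<Sum>s\<in>S. \<Sum>l\<in>words S m. f (s # l))"
  using sum_words_append[of f S "Suc 0" m]
    sum_words_Suc0[of "\<lambda>l. \<Sum>l'\<in>words S m. f (l @ l')" S] by simp

lemma sum_words_snoc:
  "(\<Sum>l\<in>words S (Suc m). f l) = (\<Sum>l\<in>words S m. \<Sum>s\<in>S. f (l @ [s]))"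
  using sum_words_append[of f S m "Suc 0"] by (simp add: sum_words_Suc0)

text \<open>Variance as second moment minus squared mean, for the vectors \<open>g s / p s\<close>
  with weights \<open>p s\<close> and mean \<open>g0 / p0\<close>, multiplied out by the weights.
  The domination by \<open>p s\<close> forces \<open>g s = 0\<close> where the weight vanishes, so
  the convention \<open>x / 0 = 0\<close> does no harm.\<close>

lemma variance_identity:
  fixes g :: "'s \<Rightarrow> 'j \<Rightarrow> complex" and p :: "'s \<Rightarrow> real"
  assumes fin: "finite S" "finite J"
    and gsum: "\<And>j. j \<in> J \<Longrightarrow> (\<Sum>s\<in>S. g s j) = g0 j" and psum: "(\<Sum>s\<in>S. p s) = p0"
    and dom: "\<And>s. s \<in> S \<Longrightarrow> L2_set (\<lambda>j. cmod (g s j)) J \<le> p s"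
  shows "(\<Sum>s\<in>S. (\<Sum>j\<in>J. (cmod (g s j - of_real (p s / p0) * g0 j))\<^sup>2) / p s)
    = (\<Sum>s\<in>S. (\<Sum>j\<in>J. (cmod (g s j))\<^sup>2) / p s) - (\<Sum>j\<in>J. (cmod (g0 j))\<^sup>2) / p0"
proof -
  have p: "p s \<ge> 0" if "s \<in> S" for s
    using dom[OF that] L2_set_nonneg order_trans by blast
  have zero: "g s j = 0" if "s \<in> S" "p s = 0" "j \<in> J" for s j
    using dom[OF that(1)] that fin L2_set_nonneg[of "\<lambda>j. cmod (g s j)" J]
    by (auto simp: L2_set_eq_0_iff dest!: order_antisym)
  show ?thesis
  proof (cases "p0 = 0")
    case True
    then have "p s = 0" if "s \<in> S" for s
      using psum p that fin sum_nonneg_eq_0_iff[of S p] by blast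
    then show ?thesis using True by simp
  next
    case False
    let ?N = "\<Sum>j\<in>J. (cmod (g0 j))\<^sup>2"
    have one: "(\<Sum>j\<in>J. (cmod (g s j - of_real (p s / p0) * g0 j))\<^sup>2) / p s
      = (\<Sum>j\<in>J. (cmod (g s j))\<^sup>2) / p s - 2 / p0 * (\<Sum>j\<in>J. Re (g s j * cnj (g0 j)))
        + p s * (?N / p0\<^sup>2)" if s: "s \<in> S" for s
    proof (cases "p s = 0")
      case True
      then show ?thesis using zero[OF s] by simp
    next
      case nz: False
      have "(cmod (x - of_real c * y))\<^sup>2 = (cmod x)\<^sup>2 - 2 * c * Re (x * cnj y) + c\<^sup>2 * (cmod y)\<^sup>2"
        for x y c unfolding cmod_power2 by (simp add: power2_eq_square algebra_simps)
      then have "(\<Sum>j\<in>J. (cmod (g s j - of_real (p s / p0) * g0 j))\<^sup>2)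
        = (\<Sum>j\<in>J. (cmod (g s j))\<^sup>2) - 2 * (p s / p0) * (\<Sum>j\<in>J. Re (g s j * cnj (g0 j)))
          + (p s / p0)\<^sup>2 * ?N"
        by (simp only: sum.distrib sum_subtractf sum_distrib_left)
      then show ?thesis using nz False by (simp add: field_simps power2_eq_square)
    qed
    have "(\<Sum>s\<in>S. \<Sum>j\<in>J. Re (g s j * cnj (g0 j))) = (\<Sum>j\<in>J. Re ((\<Sum>s\<in>S. g s j) * cnj (g0 j)))"
      by (subst sum.swap) (simp only: sum_distrib_right Re_sum)
    also have "\<dots> = ?N"
      by (rule sum.cong) (simp_all add: gsum cmod_power2 flip: power2_eq_square)
    finally have cross: "(\<Sum>s\<in>S. \<Sum>j\<in>J. Re (g s j * cnj (g0 j))) = ?N" .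
    have "(\<Sum>s\<in>S. (\<Sum>j\<in>J. (cmod (g s j - of_real (p s / p0) * g0 j))\<^sup>2) / p s)
      = (\<Sum>s\<in>S. (\<Sum>j\<in>J. (cmod (g s j))\<^sup>2) / p s)
        - 2 / p0 * (\<Sum>s\<in>S. \<Sum>j\<in>J. Re (g s j * cnj (g0 j))) + (\<Sum>s\<in>S. p s) * (?N / p0\<^sup>2)"
      by (simp only: one sum.distrib sum_subtractf sum_distrib_left[symmetric] sum_distrib_right[symmetric] cong: sum.cong)
    then show ?thesis using False
      unfolding cross psum by (simp add: field_simps power2_eq_square)
  qed
qed

text \<open>The letters of a word are successive observations, the newest at the head. By
  \<open>variance_identity\<close> the mean square increments telescope; as \<open>h l\<close> is
  bounded by \<open>t l\<close>, they add up to at most \<open>t []\<close> over \<open>k\<close>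
  steps. Some step carries at most the average, and Cauchy-Schwarz turns its mean square into a mean
  of norms.\<close>

lemma exists_small_increment:
  fixes h :: "'s list \<Rightarrow> 'j \<Rightarrow> complex" and t :: "'s list \<Rightarrow> real"
  assumes fin: "finite S" "finite J" and k: "k > 0"
    and hsum: "\<And>m l j. m < k \<Longrightarrow> l \<in> words S m \<Longrightarrow> j \<in> J \<Longrightarrow> (\<Sum>s\<in>S. h (s # l) j) = h l j"
    and tsum: "\<And>m l. m < k \<Longrightarrow> l \<in> words S m \<Longrightarrow> (\<Sum>s\<in>S. t (s # l)) = t l"
    and dom: "\<And>m l. m \<le> k \<Longrightarrow> l \<in> words S m \<Longrightarrow> L2_set (\<lambda>j. cmod (h l j)) J \<le> t l"
  shows "\<exists>m<k. (\<Sum>l\<in>words S m. \<Sum>s\<in>S.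
      L2_set (\<lambda>j. cmod (h (s # l) j - of_real (t (s # l) / t l) * h l j)) J) \<le> t [] / sqrt (real k)"
proof -
  \<comment> \<open>The potential \<open>\<Phi> m\<close> is the second moment of the martingale \<open>h l / t l\<close> under the weights \<open>t\<close>.\<close>
  define N where "N l = (\<Sum>j\<in>J. (cmod (h l j))\<^sup>2)" for l
  define inc where "inc l s = (\<Sum>j\<in>J. (cmod (h (s # l) j - of_real (t (s # l) / t l) * h l j))\<^sup>2)" for l s
  define \<Phi> where "\<Phi> m = (\<Sum>l\<in>words S m. N l / t l)" for m
  have t: "t l \<ge> 0" if "m \<le> k" "l \<in> words S m" for m l
    using dom[OF that] L2_set_nonneg order_trans by blast
  have total: "(\<Sum>l\<in>words S m. t l) = t []" if "m \<le> k" for m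
    using that
  proof (induction m)
    case (Suc m)
    have "(\<Sum>l\<in>words S (Suc m). t l) = (\<Sum>l\<in>words S m. \<Sum>s\<in>S. t (s # l))"
      unfolding sum_words_Cons by (rule sum.swap)
    also have "\<dots> = (\<Sum>l\<in>words S m. t l)"
      using Suc.prems by (intro sum.cong tsum) auto
    finally show ?case using Suc by simp
  qed simp
  have step: "\<Phi> (Suc m) - \<Phi> m = (\<Sum>l\<in>words S m. \<Sum>s\<in>S. inc l s / t (s # l))" if m: "m < k" for m
  proof -
    have "(\<Sum>s\<in>S. inc l s / t (s # l)) = (\<Sum>s\<in>S. N (s # l) / t (s # l)) - N l / t l"
      if l: "l \<in> words S m" for l
      unfolding inc_def N_def using m l hsum[OF m l] tsum[OF m l]
      by (intro variance_identity fin dom[of "Suc m"] Cons_words) auto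
    then show ?thesis
      unfolding \<Phi>_def sum_words_Cons by (subst sum.swap) (simp add: sum_subtractf)
  qed
  have "\<Phi> k \<le> (\<Sum>l\<in>words S k. t l)"
    unfolding \<Phi>_def
  proof (rule sum_mono)
    fix l assume l: "l \<in> words S k"
    have "N l = (L2_set (\<lambda>j. cmod (h l j)) J)\<^sup>2"
      unfolding N_def L2_set_def by (simp add: sum_nonneg)
    also have "\<dots> \<le> (t l)\<^sup>2" using dom[OF order_refl l] by (intro power_mono) auto
    finally show "N l / t l \<le> t l"
      using t[OF order_refl l] by (cases "t l = 0") (auto simp: field_simps power2_eq_square)
  qed
  moreover have "\<Phi> 0 \<ge> 0"
    using t[of 0 "[]"] by (simp add: \<Phi>_def N_def sum_nonneg)
  ultimately have tele: "(\<Sum>m<k. \<Phi> (Suc m) - \<Phi> m) \<le> t []"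
    using total[of k] by (simp add: sum_lessThan_telescope)
  have "\<exists>m<k. \<Phi> (Suc m) - \<Phi> m \<le> t [] / k"
  proof (rule ccontr)
    assume "\<not> ?thesis"
    then have "(\<Sum>m<k. t [] / k) < (\<Sum>m<k. \<Phi> (Suc m) - \<Phi> m)"
      using k by (intro sum_strict_mono) auto
    with tele k show False by simp
  qed
  then obtain m where m: "m < k" and small: "\<Phi> (Suc m) - \<Phi> m \<le> t [] / k" by blast
  let ?I = "words S m \<times> S"
  have "(\<Sum>l\<in>words S m. \<Sum>s\<in>S.
      L2_set (\<lambda>j. cmod (h (s # l) j - of_real (t (s # l) / t l) * h l j)) J)
    = (\<Sum>(l,s)\<in>?I. sqrt (inc l s))"
    by (simp add: inc_def L2_set_def sum.cartesian_product)
  \<comment> \<open>The weight is split off for Cauchy-Schwarz: the squares of the first factors sum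
    to the increment of \<open>\<Phi>\<close>, those of the second to \<open>t []\<close>.\<close>
  also have "\<dots> = (\<Sum>x\<in>?I. \<bar>sqrt (inc (fst x) (snd x) / t (snd x # fst x))\<bar> * \<bar>sqrt (t (snd x # fst x))\<bar>)"
  proof (rule sum.cong[OF refl], clarify)
    fix l s assume l: "l \<in> words S m" and s: "s \<in> S"
    have ls: "s # l \<in> words S (Suc m)" using l s by (rule Cons_words[rotated])
    have tn: "t (s # l) \<ge> 0" using t[OF _ ls] m by simp
    \<comment> \<open>At weight zero both \<open>h (s # l)\<close> and the coefficient of
      \<open>h l\<close> vanish, so nothing is lost by dividing by the weight.\<close>
    have "inc l s = 0" if "t (s # l) = 0"
      using dom[OF _ ls] m that L2_set_nonneg[of "\<lambda>j. cmod (h (s # l) j)" J] fin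
      by (auto simp: inc_def L2_set_eq_0_iff dest!: order_antisym)
    moreover have "inc l s \<ge> 0" by (simp add: inc_def sum_nonneg)
    ultimately show "sqrt (inc l s) = \<bar>sqrt (inc (fst (l,s)) (snd (l,s)) / t (snd (l,s) # fst (l,s)))\<bar>
      * \<bar>sqrt (t (snd (l,s) # fst (l,s)))\<bar>"
      using tn by (cases "t (s # l) = 0") (auto simp: real_sqrt_divide)
  qed
  also have "\<dots> \<le> L2_set (\<lambda>x. sqrt (inc (fst x) (snd x) / t (snd x # fst x))) ?I
    * L2_set (\<lambda>x. sqrt (t (snd x # fst x))) ?I"
    by (rule L2_set_mult_ineq)
  also have "L2_set (\<lambda>x. sqrt (t (snd x # fst x))) ?I = sqrt (t [])"
  proof -
    have "(\<Sum>x\<in>?I. (sqrt (t (snd x # fst x)))\<^sup>2) = (\<Sum>x\<in>?I. t (snd x # fst x))"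
      using t[of "Suc m"] m by (intro sum.cong) (auto simp: Cons_words)
    also have "\<dots> = (\<Sum>l\<in>words S m. \<Sum>s\<in>S. t (s # l))"
      by (simp add: sum.cartesian_product case_prod_unfold)
    also have "\<dots> = (\<Sum>l\<in>words S m. t l)"
      using m by (intro sum.cong tsum) auto
    also have "\<dots> = t []" using m by (simp add: total)
    finally show ?thesis by (simp add: L2_set_def)
  qed
  also have "L2_set (\<lambda>x. sqrt (inc (fst x) (snd x) / t (snd x # fst x))) ?I = sqrt (\<Phi> (Suc m) - \<Phi> m)"
  proof -
    have "(\<Sum>x\<in>?I. (sqrt (inc (fst x) (snd x) / t (snd x # fst x)))\<^sup>2)
      = (\<Sum>x\<in>?I. inc (fst x) (snd x) / t (snd x # fst x))"
      using t[of "Suc m"] m by (intro sum.cong) (auto simp: Cons_words inc_def sum_nonneg)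
    also have "\<dots> = \<Phi> (Suc m) - \<Phi> m"
      unfolding step[OF m] by (simp add: sum.cartesian_product case_prod_unfold)
    finally show ?thesis by (simp add: L2_set_def)
  qed
  also have "sqrt (\<Phi> (Suc m) - \<Phi> m) * sqrt (t []) \<le> sqrt (t [] / k) * sqrt (t [])"
    using small t[of 0 "[]"] by (intro mult_right_mono) auto
  also have "\<dots> = t [] / sqrt k"
    using t[of 0 "[]"] by (simp add: real_sqrt_divide)
  finally show ?thesis using m by blast
qed

section \<open>Tomographically complete probes\<close>

lemma index_less_mult: "a < m \<Longrightarrow> b < n \<Longrightarrow> a * n + b < m * (n::nat)"
proof -
  assume "a < m" "b < n"
  then have "a * n + b < Suc a * n" by simp
  also have "\<dots> \<le> m * n" using \<open>a < m\<close> by (intro mult_right_mono) auto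
  finally show ?thesis .
qed

lemma sum_lessThan_mult:
  "(\<Sum>i<m * n. f i) = (\<Sum>a<m. \<Sum>b<(n::nat). f (a * n + b))"
proof (cases "n = 0")
  case False
  have "(\<Sum>i<m * n. f i) = (\<Sum>(a,b)\<in>{..<m} \<times> {..<n}. f (a * n + b))"
  proof (rule sum.reindex_bij_witness[where i = "\<lambda>(a,b). a * n + b" and j = "\<lambda>i. (i div n, i mod n)"])
    fix x assume "x \<in> {..<m} \<times> {..<n}"
    then obtain a b where "x = (a,b)" "a < m" "b < n" by auto
    then show "(case x of (a, b) \<Rightarrow> a * n + b) \<in> {..<m * n}"
      using index_less_mult by simp
  qed (use False in \<open>auto simp: less_mult_imp_div_less\<close>)
  then show ?thesis by (simp add: sum.cartesian_product)
qed simp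

lemma div_index: "b < n \<Longrightarrow> (a * n + b) div n = (a::nat)"
  using div_mult_self3[of n a b] by auto

lemma sum_of_bool_mult:
  fixes f :: "'a \<Rightarrow> complex"
  assumes "finite S" "a \<in> S"
  shows "(\<Sum>x\<in>S. of_bool (x = a) * f x) = f a"
proof -
  have "(\<Sum>x\<in>S. of_bool (x = a) * f x) = (\<Sum>x\<in>S. if x = a then f x else 0)"
    by (intro sum.cong) auto
  then show ?thesis using assms by simp
qed

text \<open>A setting is a pair of basis indices with a phase exponent. The case
  \<open>p = q\<close> is included, so that diagonal entries are recovered by the same polarization
  formula as the others.\<close>

definition settings :: "nat \<Rightarrow> (nat \<times> nat \<times> nat) set" where
  "settings d = {..<d} \<times> {..<d} \<times> {..<4}"

text \<open>The vectors \<open>e\<^sub>p + \<i>\<^sup>s e\<^sub>q\<close> of the polarization identity, scaled so that their projectors sum to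
  the maximally mixed state \<open>I / d\<close>.\<close>

definition probe :: "nat \<Rightarrow> nat \<times> nat \<times> nat \<Rightarrow> nat \<Rightarrow> complex" where
  "probe d z b = (case z of (p,q,s) \<Rightarrow>
     complex_of_real (1 / (sqrt 8 * real d)) * (of_bool (b = p) + \<i> ^ s * of_bool (b = q)))"

lemma finite_settings [simp]: "finite (settings d)"
  by (simp add: settings_def)

lemma probe_pair:
  "cnj (probe d (p,q,s) b) * probe d (p,q,s) b' = 1 / (8 * of_nat d ^ 2)
     * ((of_bool (b = p) + (-\<i>) ^ s * of_bool (b = q)) * (of_bool (b' = p) + \<i> ^ s * of_bool (b' = q)))"
proof -
  have "complex_of_real (1 / (sqrt 8 * real d)) * complex_of_real (1 / (sqrt 8 * real d))
    = complex_of_real (1 / (8 * real d ^ 2))"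
    unfolding of_real_mult[symmetric]
    by (rule arg_cong[where f = complex_of_real]) (simp add: power2_eq_square)
  then have c: "complex_of_real (1 / (sqrt 8 * real d)) * complex_of_real (1 / (sqrt 8 * real d))
    = 1 / (8 * of_nat d ^ 2)" by simp
  have "cnj (probe d (p,q,s) b) * probe d (p,q,s) b'
    = (complex_of_real (1 / (sqrt 8 * real d)) * complex_of_real (1 / (sqrt 8 * real d)))
     * ((of_bool (b = p) + (-\<i>) ^ s * of_bool (b = q)) * (of_bool (b' = p) + \<i> ^ s * of_bool (b' = q)))"
    by (simp add: probe_def)
  then show ?thesis unfolding c .
qed

text \<open>Nontrivial powers of the phase sum to 0 over \<open>s < 4\<close>. The first sum keeps
  the products without phase; in the second the factor \<open>(-\<i>) ^ s\<close> cancels the phase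
  of a single cross term, which alone survives.\<close>

lemma sum_phases:
  "(\<Sum>s<4. (of_bool A + (-\<i>) ^ s * of_bool B) * (of_bool A' + \<i> ^ s * of_bool B'))
    = 4 * (of_bool (A \<and> A') + of_bool (B \<and> B') :: complex)"
  "(\<Sum>s<4. (-\<i>) ^ s * ((of_bool A + (-\<i>) ^ s * of_bool B) * (of_bool A' + \<i> ^ s * of_bool B')))
    = 4 * (of_bool (A \<and> B') :: complex)"
  by (cases A; cases B; cases A'; cases B'; simp add: eval_nat_numeral algebra_simps)+

text \<open>Through \<open>sum_contract_complete\<close>, probing a system and forgetting the probe
  amounts to tracing the system out, up to the factor \<open>1 / d\<close>.\<close>

lemma probe_complete:
  assumes "b < d" "b' < d"
  shows "(\<Sum>z\<in>settings d. cnj (probe d z b) * probe d z b') = of_bool (b = b') / of_nat d"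
proof -
  have "(\<Sum>z\<in>settings d. cnj (probe d z b) * probe d z b')
    = (\<Sum>p<d. \<Sum>q<d. \<Sum>s<4. cnj (probe d (p,q,s) b) * probe d (p,q,s) b')"
    by (simp add: settings_def sum.cartesian_product case_prod_unfold)
  also have "\<dots> = (\<Sum>p<d. \<Sum>q<d. 1 / (2 * of_nat d ^ 2)
      * (of_bool (b = p \<and> b' = p) + of_bool (b = q \<and> b' = q)))"
    unfolding probe_pair sum_distrib_left[symmetric] sum_phases by simp
  also have "\<dots> = 1 / (2 * of_nat d ^ 2) * (2 * of_nat d * of_bool (b = b'))"
  proof -
    have "(\<Sum>p<d. of_bool (b = p \<and> b' = p) :: complex) = of_bool (b = b')"
    proof -
      have "(\<Sum>p<d. of_bool (b = p \<and> b' = p) :: complex) = (\<Sum>p<d. of_bool (p = b) * of_bool (b = b'))"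
        by (intro sum.cong) auto
      then show ?thesis using assms by (simp only: sum_of_bool_mult finite_lessThan lessThan_iff)
    qed
    then show ?thesis
      by (simp only: sum_distrib_left[symmetric] sum.distrib sum_constant card_lessThan)
         (simp add: sum_distrib_left[symmetric])
  qed
  also have "\<dots> = of_bool (b = b') / of_nat d"
    using assms by (simp add: power2_eq_square)
  finally show ?thesis .
qed

lemma probe_polarization:
  "(\<Sum>s<4. (-\<i>) ^ s * (cnj (probe d (p,q,s) b) * probe d (p,q,s) b'))
    = of_bool (b = p \<and> b' = q) / (2 * of_nat d ^ 2)"
proof -
  have "(\<Sum>s<4. (-\<i>) ^ s * (cnj (probe d (p,q,s) b) * probe d (p,q,s) b')) = 1 / (8 * of_nat d ^ 2) *
    (\<Sum>s<4. (-\<i>) ^ s * ((of_bool (b = p) + (-\<i>) ^ s * of_bool (b = q)) * (of_bool (b' = p) + \<i> ^ s * of_bool (b' = q))))"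
    unfolding probe_pair sum_distrib_left by (simp add: mult_ac)
  then show ?thesis unfolding sum_phases by simp
qed

section \<open>Quadratic forms and the inversion of the tomography\<close>

definition contract :: "nat \<Rightarrow> (nat \<Rightarrow> complex) \<Rightarrow> (nat \<Rightarrow> nat \<Rightarrow> complex) \<Rightarrow> complex" where
  "contract d u f = (\<Sum>b<d. \<Sum>b'<d. cnj (u b) * f b b' * u b')"

lemma contract_sum: "contract d u (\<lambda>b b'. \<Sum>x\<in>X. f x b b') = (\<Sum>x\<in>X. contract d u (f x))"
proof -
  have "contract d u (\<lambda>b b'. \<Sum>x\<in>X. f x b b') = (\<Sum>b<d. \<Sum>b'<d. \<Sum>x\<in>X. cnj (u b) * f x b b' * u b')"
    by (simp add: contract_def sum_distrib_left sum_distrib_right)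
  also have "\<dots> = (\<Sum>b<d. \<Sum>x\<in>X. \<Sum>b'<d. cnj (u b) * f x b b' * u b')"
    by (intro sum.cong refl) (rule sum.swap)
  also have "\<dots> = (\<Sum>x\<in>X. contract d u (f x))"
    unfolding contract_def by (rule sum.swap)
  finally show ?thesis .
qed

lemma contract_diff: "contract d u (\<lambda>b b'. f b b' - g b b') = contract d u f - contract d u g"
  by (simp add: contract_def algebra_simps sum_subtractf)

lemma contract_scale: "contract d u (\<lambda>b b'. c * f b b') = c * contract d u f"
  by (simp add: contract_def sum_distrib_left mult_ac)

lemma contract_cong:
  "(\<And>b b'. b < d \<Longrightarrow> b' < d \<Longrightarrow> f b b' = g b b') \<Longrightarrow> contract d u f = contract d u g"
  by (simp add: contract_def)

text \<open>The normalisation \<open>c\<close> is left open: it will be \<open>d\<close> for a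
  single probe and \<open>d ^ r\<close> for product probes of \<open>r\<close> systems.\<close>

lemma sum_contract_complete:
  assumes "\<And>b b'. b < d \<Longrightarrow> b' < d \<Longrightarrow> (\<Sum>z\<in>Z. cnj (v z b) * v z b') = of_bool (b = b') / c"
  shows "(\<Sum>z\<in>Z. contract d (v z) f) = (\<Sum>b<d. f b b) / c"
proof -
  have "(\<Sum>z\<in>Z. contract d (v z) f)
    = (\<Sum>b<d. \<Sum>b'<d. f b b' * (\<Sum>z\<in>Z. cnj (v z b) * v z b'))"
    unfolding contract_def
    by (subst sum.swap, rule sum.cong[OF refl], subst sum.swap)
       (simp add: sum_distrib_left mult_ac)
  also have "\<dots> = (\<Sum>b<d. \<Sum>b'<d. of_bool (b' = b) * (f b b' / c))"
    by (intro sum.cong refl) (auto simp: assms)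
  also have "\<dots> = (\<Sum>b<d. f b b) / c"
    unfolding sum_divide_distrib by (intro sum.cong refl sum_of_bool_mult) auto
  finally show ?thesis .
qed

text \<open>Operators are functions of two indices, so a tensor factor is isolated by substituting
  \<open>a * n + b\<close>, and probing one factor is again a \<open>contract\<close>.\<close>

lemma contract_tensor:
  assumes "\<And>a b. a < m \<Longrightarrow> b < n \<Longrightarrow> u (a * n + b) = x a * y b"
  shows "contract (m * n) u f = contract m x (\<lambda>a a'. contract n y (\<lambda>b b'. f (a * n + b) (a' * n + b')))"
proof -
  have "contract (m * n) u f = (\<Sum>a<m. \<Sum>b<n. \<Sum>a'<m. \<Sum>b'<n.
      cnj (x a) * (cnj (y b) * f (a * n + b) (a' * n + b') * y b') * x a')"
    unfolding contract_def sum_lessThan_mult by (intro sum.cong refl) (simp add: assms mult_ac)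
  also have "\<dots> = (\<Sum>a<m. \<Sum>a'<m. \<Sum>b<n. \<Sum>b'<n.
      cnj (x a) * (cnj (y b) * f (a * n + b) (a' * n + b') * y b') * x a')"
    by (rule sum.cong[OF refl]) (rule sum.swap)
  also have "\<dots> = contract m x (\<lambda>a a'. contract n y (\<lambda>b b'. f (a * n + b) (a' * n + b')))"
    by (simp only: contract_def sum_distrib_left sum_distrib_right)
  finally show ?thesis .
qed

lemma contract_swap:
  "contract m x (\<lambda>a a'. contract n y (f a a')) = contract n y (\<lambda>b b'. contract m x (\<lambda>a a'. f a a' b b'))"
proof -
  have "contract n y (f a a') = (\<Sum>b<n. \<Sum>b'<n. (cnj (y b) * y b') * f a a' b b')" for a a'
    by (simp add: contract_def mult_ac)
  then have "contract m x (\<lambda>a a'. contract n y (f a a'))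
    = contract m x (\<lambda>a a'. \<Sum>b<n. \<Sum>b'<n. (cnj (y b) * y b') * f a a' b b')" by simp
  also have "\<dots> = (\<Sum>b<n. contract m x (\<lambda>a a'. \<Sum>b'<n. (cnj (y b) * y b') * f a a' b b'))"
    by (rule contract_sum)
  also have "\<dots> = (\<Sum>b<n. \<Sum>b'<n. (cnj (y b) * y b') * contract m x (\<lambda>a a'. f a a' b b'))"
    by (rule sum.cong[OF refl]) (simp only: contract_sum contract_scale)
  also have "\<dots> = contract n y (\<lambda>b b'. contract m x (\<lambda>a a'. f a a' b b'))"
    unfolding contract_def[of n] by (simp add: mult_ac)
  finally show ?thesis .
qed

text \<open>The factor \<open>2 d^2\<close> undoes the scale \<open>1 / (8 d^2)\<close> of
  \<open>probe_pair\<close> times the 4 of \<open>sum_phases\<close>.\<close>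

lemma entry_from_contract_probe:
  assumes "p < d" "q < d"
  shows "f p q = 2 * of_nat d ^ 2 * (\<Sum>s<4. (-\<i>) ^ s * contract d (probe d (p,q,s)) f)"
proof -
  have "(\<Sum>s<4. (-\<i>) ^ s * contract d (probe d (p,q,s)) f)
    = (\<Sum>b<d. \<Sum>b'<d. f b b' * (\<Sum>s<4. (-\<i>) ^ s * (cnj (probe d (p,q,s) b) * probe d (p,q,s) b')))"
    unfolding contract_def sum_distrib_left
    by (subst sum.swap, rule sum.cong[OF refl], subst sum.swap) (simp add: mult_ac)
  also have "\<dots> = (\<Sum>b<d. \<Sum>b'<d. of_bool (b = p \<and> b' = q) * (f p q / (2 * of_nat d ^ 2)))"
    unfolding probe_polarization by (intro sum.cong refl) auto
  also have "\<dots> = (\<Sum>b<d. of_bool (b = p) * (\<Sum>b'<d. of_bool (b' = q) * (f p q / (2 * of_nat d ^ 2))))"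
    by (simp add: sum_distrib_left of_bool_conj mult.assoc)
  also have "\<dots> = f p q / (2 * of_nat d ^ 2)"
    using assms by (simp only: sum_of_bool_mult finite_lessThan lessThan_iff)
  finally show ?thesis using assms by simp
qed

text \<open>The head of the list probes the most significant digit, in agreement with the ordering
  of \<open>B_1, ..., B_k\<close>.\<close>

fun probe_product :: "nat \<Rightarrow> (nat \<times> nat \<times> nat) list \<Rightarrow> nat \<Rightarrow> complex" where
  "probe_product d [] x = 1"
| "probe_product d (z # zs) x = probe d z (x div d ^ length zs) * probe_product d zs (x mod d ^ length zs)"

lemma probe_product_Cons_index:
  "x < d ^ length zs \<Longrightarrow> probe_product d (z # zs) (b * d ^ length zs + x) = probe d z b * probe_product d zs x"
  by (simp add: div_index)

text \<open>The counterpart of \<open>probe_product_Cons_index\<close> for the last system; both are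
  needed to compare a record with its cyclic shift.\<close>

lemma probe_product_snoc_index:
  assumes "b < d"
  shows "x < d ^ length zs \<Longrightarrow> probe_product d (zs @ [z]) (x * d + b) = probe_product d zs x * probe d z b"
proof (induction zs arbitrary: x)
  case (Cons z' zs)
  have d: "d > 0" using assms by simp
  have 1: "(x * d + b) div (d * d ^ length zs) = x div d ^ length zs"
    using assms by (simp add: div_mult2_eq)
  have 2: "(x * d + b) mod (d * d ^ length zs) = (x mod d ^ length zs) * d + b"
    using assms by (simp add: mod_mult2_eq)
  have "probe_product d (zs @ [z]) ((x mod d ^ length zs) * d + b) = probe_product d zs (x mod d ^ length zs) * probe d z b"
    using d by (intro Cons.IH) simp
  then show ?case by (simp add: 1 2)
qed simp

lemma probe_product_complete:
  assumes "x < d ^ r" "x' < d ^ r"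
  shows "(\<Sum>zs\<in>words (settings d) r. cnj (probe_product d zs x) * probe_product d zs x') = of_bool (x = x') / of_nat d ^ r"
  using assms
proof (induction r arbitrary: x x')
  case (Suc r)
  then have d: "d > 0" by (cases d) auto
  have len: "length zs = r" if "zs \<in> words (settings d) r" for zs
    using that by (simp add: words_def)
  have xd: "x div d ^ r < d" "x' div d ^ r < d" using Suc.prems by (auto simp: less_mult_imp_div_less)
  have "(\<Sum>zs\<in>words (settings d) (Suc r). cnj (probe_product d zs x) * probe_product d zs x')
    = (\<Sum>z\<in>settings d. \<Sum>zs\<in>words (settings d) r.
        (cnj (probe d z (x div d ^ r)) * probe d z (x' div d ^ r)) *
        (cnj (probe_product d zs (x mod d ^ r)) * probe_product d zs (x' mod d ^ r)))"
    unfolding sum_words_Cons by (intro sum.cong refl) (simp add: len)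
  also have "\<dots> = (of_bool (x div d ^ r = x' div d ^ r) / of_nat d) *
      (of_bool (x mod d ^ r = x' mod d ^ r) / of_nat d ^ r)"
    using d by (simp add: sum_product[symmetric] Suc.IH probe_complete[OF xd])
  also have "\<dots> = of_bool (x = x') / of_nat d ^ Suc r"
  proof -
    have "(x div d ^ r = x' div d ^ r \<and> x mod d ^ r = x' mod d ^ r) = (x = x')"
      by (metis div_mult_mod_eq)
    then show ?thesis by (auto simp flip: of_bool_conj)
  qed
  finally show ?case .
qed simp

lemma sum_words_times:
  "(\<Sum>l\<in>words (A \<times> B) r. f (map fst l) (map snd l)) = (\<Sum>xs\<in>words A r. \<Sum>ys\<in>words B r. f xs ys)"
proof -
  have "(\<Sum>l\<in>words (A \<times> B) r. f (map fst l) (map snd l)) = (\<Sum>(xs,ys)\<in>words A r \<times> words B r. f xs ys)"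
    by (rule sum.reindex_bij_witness[where i = "\<lambda>(xs,ys). zip xs ys" and j = "\<lambda>l. (map fst l, map snd l)"])
       (auto simp: words_def zip_map_fst_snd dest: set_zip_leftD set_zip_rightD)
  then show ?thesis by (simp add: sum.cartesian_product)
qed

section \<open>Positive forms\<close>

text \<open>In the order on complex numbers \<open>0 \<le> z\<close> says that \<open>z\<close> is
  real and nonnegative, as in \<open>psd\<close>. On index functions, sums and contractions need no
  carrier conditions.\<close>

definition pos_form :: "nat \<Rightarrow> (nat \<Rightarrow> nat \<Rightarrow> complex) \<Rightarrow> bool" where
  "pos_form n f \<longleftrightarrow> (\<forall>u. 0 \<le> contract n u f)"

lemma pos_formD: "pos_form n f \<Longrightarrow> 0 \<le> contract n u f"
  by (simp add: pos_form_def)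

lemma psd_iff_pos_form: "psd n M \<longleftrightarrow> M \<in> carrier_mat n n \<and> pos_form n (\<lambda>i j. M $$ (i,j))"
proof -
  have "0 \<le> contract n u (\<lambda>i j. M $$ (i,j))"
    if "\<And>v. v \<in> carrier_vec n \<Longrightarrow> 0 \<le> contract n (vec_index v) (\<lambda>i j. M $$ (i,j))" for u
    using that[of "vec n u"] by (simp add: contract_def)
  moreover have "(let q = z in Im q = 0 \<and> Re q \<ge> 0) \<longleftrightarrow> 0 \<le> z" for z :: complex
    by (auto simp: Let_def less_eq_complex_def)
  ultimately show ?thesis
    unfolding psd_def pos_form_def contract_def[symmetric] by metis
qed

lemma pos_form_cong:
  "(\<And>i j. i < n \<Longrightarrow> j < n \<Longrightarrow> f i j = g i j) \<Longrightarrow> pos_form n f = pos_form n g"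
  using contract_cong[of n f g] by (simp add: pos_form_def)

lemma pos_form_sum: "(\<And>x. x \<in> X \<Longrightarrow> pos_form n (f x)) \<Longrightarrow> pos_form n (\<lambda>i j. \<Sum>x\<in>X. f x i j)"
  unfolding pos_form_def contract_sum by (auto intro: sum_nonneg)

lemma pos_form_scale: "c \<ge> 0 \<Longrightarrow> pos_form n f \<Longrightarrow> pos_form n (\<lambda>i j. of_real c * f i j)"
  unfolding pos_form_def contract_scale by (simp add: less_eq_complex_def)

lemma cnj_of_bool: "cnj (of_bool Q) = of_bool Q"
  by (cases Q) auto

text \<open>Test vectors \<open>x e_i + y e_j\<close> yield the entrywise facts on positive forms
  below; \<open>i = j\<close> is allowed.\<close>

lemma contract_two:
  assumes "i < n" "j < n"
  shows "contract n (\<lambda>k. of_bool (k = i) * x + of_bool (k = j) * y) f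
    = cnj x * f i i * x + cnj x * f i j * y + cnj y * f j i * x + cnj y * f j j * y"
proof -
  have "(\<Sum>b'<n. c * f b b' * (of_bool (b' = i) * x + of_bool (b' = j) * y))
    = c * (f b i * x + f b j * y)" for c b
  proof -
    have "(\<Sum>b'<n. c * f b b' * (of_bool (b' = i) * x + of_bool (b' = j) * y))
      = (\<Sum>b'<n. of_bool (b' = i) * (c * f b b' * x)) + (\<Sum>b'<n. of_bool (b' = j) * (c * f b b' * y))"
      by (simp only: sum.distrib[symmetric]) (simp only: algebra_simps)
    then show ?thesis using assms
      by (simp only: sum_of_bool_mult finite_lessThan lessThan_iff) (simp add: algebra_simps)
  qed
  note inner = this
  have "(\<Sum>b<n. cnj (of_bool (b = i) * x + of_bool (b = j) * y) * g b) = cnj x * g i + cnj y * g j" for g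
  proof -
    have "(\<Sum>b<n. cnj (of_bool (b = i) * x + of_bool (b = j) * y) * g b)
      = (\<Sum>b<n. of_bool (b = i) * (cnj x * g b)) + (\<Sum>b<n. of_bool (b = j) * (cnj y * g b))"
      by (simp only: sum.distrib[symmetric]) (simp add: algebra_simps cnj_of_bool)
    then show ?thesis using assms
      by (simp only: sum_of_bool_mult finite_lessThan lessThan_iff)
  qed
  note outer = this
  show ?thesis unfolding contract_def inner outer by (simp add: algebra_simps)
qed

lemma pos_form_two:
  assumes "pos_form n f" "i < n" "j < n"
  shows "0 \<le> cnj x * f i i * x + cnj x * f i j * y + cnj y * f j i * x + cnj y * f j j * y"
  using pos_formD[OF assms(1)] contract_two[OF assms(2,3)] by metis

lemma pos_form_diag: "pos_form n f \<Longrightarrow> i < n \<Longrightarrow> 0 \<le> f i i"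
  using pos_form_two[of n f i i 1 0] by simp

lemma pos_form_hermitian:
  assumes "pos_form n f" "i < n" "j < n"
  shows "f j i = cnj (f i j)"
proof -
  have d: "Im (f i i) = 0" "Im (f j j) = 0"
    using pos_form_diag[OF assms(1)] assms(2,3) by (auto simp: less_eq_complex_def)
  \<comment> \<open>The form is real at \<open>e_i + e_j\<close> and at
    \<open>e_i + \<i> e_j\<close>; the first gives the imaginary part of the claim, the second the
    real part.\<close>
  show ?thesis
    using pos_form_two[OF assms, of 1 1] pos_form_two[OF assms, of 1 \<i>] d
    by (auto simp: less_eq_complex_def complex_eq_iff)
qed

lemma discriminant_le:
  fixes a c e :: real
  assumes "\<And>s. 0 \<le> a + c * s\<^sup>2 - 2 * s * e" and c: "c \<ge> 0"
  shows "e\<^sup>2 \<le> a * c"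
proof (cases "c = 0")
  case True
  have "e = 0"
  proof (rule ccontr)
    assume "e \<noteq> 0"
    \<comment> \<open>With \<open>c = 0\<close> the quadratic takes the value -1 at this
      point.\<close>
    then show False using assms(1)[of "(a + 1) / (2 * e)"] True by simp
  qed
  then show ?thesis using True by simp
next
  case False
  have "c * (e / c)\<^sup>2 = e\<^sup>2 / c" "2 * (e / c) * e = 2 * (e\<^sup>2 / c)"
    using False by (simp_all add: power2_eq_square)
  then have "0 \<le> a - e\<^sup>2 / c" using assms(1)[of "e / c"] by linarith
  then show ?thesis using False c by (simp add: field_simps)
qed

text \<open>Test vectors \<open>e_i + y e_j\<close>, where the phase of \<open>y\<close> cancels
  that of \<open>f i j\<close>, bound a real quadratic in \<open>s\<close> from below by 0; its
  discriminant gives the claim.\<close>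

lemma pos_form_entry_le:
  assumes "pos_form n f" "i < n" "j < n"
  shows "(cmod (f i j))\<^sup>2 \<le> Re (f i i) * Re (f j j)"
proof (rule discriminant_le)
  show "Re (f j j) \<ge> 0" using pos_form_diag[OF assms(1,3)] by (simp add: less_eq_complex_def)
  fix s :: real
  define y where "y = - of_real s * cnj (sgn (f i j))"
  have "f i j * cnj (sgn (f i j)) = of_real (cmod (f i j))"
  proof -
    have "f i j * cnj (f i j) = of_real (cmod (f i j)) * of_real (cmod (f i j))"
      unfolding complex_norm_square[symmetric] by (simp add: power2_eq_square)
    then show ?thesis by (cases "f i j = 0") (simp_all add: sgn_eq)
  qed
  then have 1: "f i j * y = - of_real (s * cmod (f i j))"
    by (simp add: y_def mult.left_commute)
  have "cnj (f i j * y) = cnj (- of_real (s * cmod (f i j)))" using 1 by simp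
  then have 2: "cnj y * f j i = - of_real (s * cmod (f i j))"
    unfolding pos_form_hermitian[OF assms] by (simp add: mult.commute)
  have 3: "Re (cnj y * f j j * y) \<le> Re (f j j) * s\<^sup>2"
  proof -
    have a: "cnj y * y = of_real ((cmod y)\<^sup>2)" unfolding complex_norm_square by (rule mult.commute)
    \<comment> \<open>An inequality, since \<open>sgn\<close> is 0 at 0 and then
      \<open>y = 0\<close>.\<close>
    have b: "cmod y \<le> \<bar>s\<bar>" by (simp add: y_def norm_mult norm_sgn)
    have "Re (cnj y * f j j * y) = Re (f j j * of_real ((cmod y)\<^sup>2))"
      by (simp only: a[symmetric] mult_ac)
    also have "\<dots> = Re (f j j) * (cmod y)\<^sup>2" by simp
    also have "\<dots> \<le> Re (f j j) * s\<^sup>2"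
      using b pos_form_diag[OF assms(1,3)] abs_le_square_iff[of "cmod y" s]
      by (intro mult_left_mono) (auto simp: less_eq_complex_def)
    finally show ?thesis .
  qed
  show "0 \<le> Re (f i i) + Re (f j j) * s\<^sup>2 - 2 * s * cmod (f i j)"
  proof -
    have "0 \<le> f i i + f i j * y + cnj y * f j i + cnj y * f j j * y"
      using pos_form_two[OF assms, of 1 y] by simp
    then have "0 \<le> Re (f i i) - s * cmod (f i j) - s * cmod (f i j) + Re (cnj y * f j j * y)"
      unfolding 1 2 less_eq_complex_def plus_complex.sel uminus_complex.sel Re_complex_of_real by simp
    then show ?thesis using 3 by linarith
  qed
qed

text \<open>The bounds \<open>f i i * f j j\<close> on the squared entries sum to the squared trace.
  This will keep the martingale of normalised operators in the unit ball.\<close>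

lemma pos_form_hilbert_schmidt_le_trace:
  assumes "pos_form n f"
  shows "L2_set (\<lambda>(i,j). cmod (f i j)) ({..<n} \<times> {..<n}) \<le> Re (\<Sum>i<n. f i i)"
proof -
  have "(\<Sum>(i,j)\<in>{..<n} \<times> {..<n}. (cmod (f i j))\<^sup>2) \<le> (\<Sum>(i,j)\<in>{..<n} \<times> {..<n}. Re (f i i) * Re (f j j))"
    by (intro sum_mono) (auto intro: pos_form_entry_le[OF assms])
  also have "\<dots> = (Re (\<Sum>i<n. f i i))\<^sup>2"
    by (simp add: power2_eq_square sum_product sum.cartesian_product)
  finally have "(\<Sum>(i,j)\<in>{..<n} \<times> {..<n}. (cmod (f i j))\<^sup>2) \<le> (Re (\<Sum>i<n. f i i))\<^sup>2" .
  moreover have "0 \<le> Re (\<Sum>i<n. f i i)"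
    using pos_form_diag[OF assms] by (auto simp: less_eq_complex_def intro!: sum_nonneg)
  ultimately show ?thesis
    unfolding L2_set_def by (intro real_le_lsqrt) (auto simp: case_prod_unfold)
qed

section \<open>Gram factorisation and tensor products of positive forms\<close>

lemma contract_Suc:
  "contract (Suc n) u f = contract n u f + (\<Sum>i<n. cnj (u i) * f i n) * u n
    + cnj (u n) * (\<Sum>j<n. f n j * u j) + cnj (u n) * f n n * u n"
  by (simp add: contract_def sum.distrib sum_distrib_left sum_distrib_right mult.assoc)

lemma contract_rank_one: "contract n u (\<lambda>i j. w i * cnj (w j)) = (\<Sum>i<n. cnj (u i) * w i) * cnj (\<Sum>i<n. cnj (u i) * w i)"
  unfolding contract_def cnj_sum sum_product by (simp add: mult_ac)

lemma mult_cnj_nonneg: "0 \<le> z * cnj z"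
  by (simp add: less_eq_complex_def)

text \<open>Cholesky factorisation by induction: \<open>w\<close>, the last column divided by the
  root of the corner entry, is split off as a rank-one form, and the Schur complement
  \<open>f'\<close> is positive on the remaining coordinates. It serves to prove
  \<open>pos_form_tensor\<close>.\<close>

lemma pos_form_gram:
  "pos_form n f \<Longrightarrow> \<exists>W. \<forall>i<n. \<forall>j<n. f i j = (\<Sum>k<n. W k i * cnj (W k j))"
proof (induction n arbitrary: f)
  case (Suc n)
  note herm = pos_form_hermitian[OF Suc.prems]
  define c where "c = Re (f n n)"
  have fnn: "f n n = of_real c" and c: "c \<ge> 0"
    using pos_form_diag[OF Suc.prems, of n] by (auto simp: less_eq_complex_def complex_eq_iff c_def)
  define w where "w i = f i n / of_real (sqrt c)" for i
  have cc: "of_real (sqrt c) * of_real (sqrt c) = complex_of_real c"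
    unfolding of_real_mult[symmetric] using c by simp
  \<comment> \<open>If the corner entry is 0, so is the whole last column, and \<open>w = 0\<close>
    by division by zero is the right value.\<close>
  have f0: "f i n = 0" if "c = 0" "i < Suc n" for i
    using pos_form_entry_le[OF Suc.prems that(2), of n] that by (simp add: c_def)
  have fin: "f i n = w i * cnj (w n)" if "i < Suc n" for i
    using f0[OF _ that] cc by (cases "c = 0") (auto simp: w_def fnn)
  define f' where "f' i j = f i j - w i * cnj (w j)" for i j
  have "pos_form n f'"
    unfolding pos_form_def
  proof
    fix u
    \<comment> \<open>\<open>x\<close> is the minimiser of the form in the last coordinate.\<close>
    let ?s = "\<Sum>i<n. cnj (u i) * f i n"
    define x where "x = - cnj ?s / of_real c"
    have "(\<Sum>j<n. f n j * u j) = cnj ?s" using herm[of _ n] by (simp add: mult.commute)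
    moreover define v where "v i = (if i = n then x else u i)" for i
    moreover have "contract n v f = contract n u f" by (simp add: contract_def v_def)
    moreover have "(\<Sum>i<n. cnj (v i) * f i n) = ?s" "(\<Sum>j<n. f n j * v j) = (\<Sum>j<n. f n j * u j)"
      by (simp_all add: v_def)
    ultimately have "0 \<le> contract n u f + ?s * x + cnj x * cnj ?s + cnj x * of_real c * x"
      using pos_formD[OF Suc.prems, of v] unfolding contract_Suc fnn by simp
    also have "?s * x + cnj x * cnj ?s + cnj x * of_real c * x = - (?s * cnj ?s / of_real c)"
      by (cases "c = 0") (simp_all add: x_def field_simps del: cnj_sum)
    then have "contract n u f + ?s * x + cnj x * cnj ?s + cnj x * of_real c * x
      = contract n u f - ?s * cnj ?s / of_real c" by (simp add: algebra_simps)
    also have "?s * cnj ?s / of_real c = (\<Sum>i<n. cnj (u i) * w i) * cnj (\<Sum>i<n. cnj (u i) * w i)"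
    proof -
      have "(\<Sum>i<n. cnj (u i) * w i) = ?s / of_real (sqrt c)"
        by (simp add: w_def sum_divide_distrib)
      then show ?thesis by (simp add: cc del: cnj_sum)
    qed
    finally show "0 \<le> contract n u f'"
      unfolding f'_def contract_diff contract_rank_one .
  qed
  from Suc.IH[OF this] obtain W where W: "\<And>i j. i < n \<Longrightarrow> j < n \<Longrightarrow> f' i j = (\<Sum>k<n. W k i * cnj (W k j))"
    by blast
  \<comment> \<open>The new row is \<open>w\<close>; the old rows are extended by 0 in the new
    coordinate.\<close>
  define W' where "W' k i = (if k = n then w i else if i = n then 0 else W k i)" for k i
  have "f i j = (\<Sum>k<Suc n. W' k i * cnj (W' k j))" if ij: "i < Suc n" "j < Suc n" for i j
  proof -
    have sum: "(\<Sum>k<Suc n. W' k i * cnj (W' k j)) = (\<Sum>k<n. W' k i * cnj (W' k j)) + w i * cnj (w j)"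
      by (simp add: W'_def)
    consider "i < n" "j < n" | "j = n" | "i = n" using ij by linarith
    then show ?thesis
    proof cases
      case 1
      have "(\<Sum>k<n. W' k i * cnj (W' k j)) = f' i j"
        unfolding W[OF 1] using 1 by (intro sum.cong) (auto simp: W'_def)
      then show ?thesis unfolding sum by (simp add: f'_def)
    next
      case 2
      then have "(\<Sum>k<n. W' k i * cnj (W' k j)) = 0" by (intro sum.neutral) (auto simp: W'_def)
      then show ?thesis unfolding sum using fin[OF ij(1)] 2 by simp
    next
      case 3
      then have "(\<Sum>k<n. W' k i * cnj (W' k j)) = 0" by (intro sum.neutral) (auto simp: W'_def)
      moreover have "f n j = w n * cnj (w j)" using herm[OF ij(2), of n] fin[OF ij(2)] by simp
      ultimately show ?thesis unfolding sum using 3 by simp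
    qed
  qed
  then show ?case by blast
qed simp

text \<open>The Gram factorisation of \<open>f\<close> reduces the claim to rank-one
  \<open>f\<close>. Contracting the test vector with that one vector leaves a vector
  \<open>x\<close> on the second factor, at which \<open>g\<close> is evaluated.\<close>

lemma pos_form_tensor:
  assumes f: "pos_form m f" and g: "pos_form n g"
  shows "pos_form (m * n) (\<lambda>i j. f (i div n) (j div n) * g (i mod n) (j mod n))"
proof -
  obtain W where W: "\<And>i j. i < m \<Longrightarrow> j < m \<Longrightarrow> f i j = (\<Sum>k<m. W k i * cnj (W k j))"
    using pos_form_gram[OF f] by blast
  have "pos_form (m * n) (\<lambda>i j. W k (i div n) * cnj (W k (j div n)) * g (i mod n) (j mod n))" for k
    unfolding pos_form_def
  proof
    fix u
    define x where "x b = (\<Sum>a<m. cnj (W k a) * u (a * n + b))" for b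
    have "contract (m * n) u (\<lambda>i j. W k (i div n) * cnj (W k (j div n)) * g (i mod n) (j mod n))
      = (\<Sum>a<m. \<Sum>b<n. \<Sum>a'<m. \<Sum>b'<n. cnj (cnj (W k a) * u (a * n + b)) * g b b'
          * (cnj (W k a') * u (a' * n + b')))"
      unfolding contract_def sum_lessThan_mult
      by (intro sum.cong refl) (simp add: div_index mult_ac)
    also have "\<dots> = (\<Sum>a<m. \<Sum>b<n. \<Sum>b'<n. \<Sum>a'<m. cnj (cnj (W k a) * u (a * n + b)) * g b b'
          * (cnj (W k a') * u (a' * n + b')))"
      by (rule sum.cong[OF refl], rule sum.cong[OF refl]) (rule sum.swap)
    also have "\<dots> = (\<Sum>b<n. \<Sum>a<m. \<Sum>b'<n. cnj (cnj (W k a) * u (a * n + b)) * g b b' * x b')"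
      unfolding x_def sum_distrib_left by (rule sum.swap)
    also have "\<dots> = (\<Sum>b<n. \<Sum>b'<n. \<Sum>a<m. cnj (cnj (W k a) * u (a * n + b)) * g b b' * x b')"
      by (rule sum.cong[OF refl]) (rule sum.swap)
    also have "\<dots> = contract n x g"
    proof -
      have "cnj (x b) = (\<Sum>a<m. cnj (cnj (W k a) * u (a * n + b)))" for b
        by (simp only: x_def cnj_sum)
      then show ?thesis unfolding contract_def by (simp only: sum_distrib_right)
    qed
    finally show "0 \<le> contract (m * n) u (\<lambda>i j. W k (i div n) * cnj (W k (j div n)) * g (i mod n) (j mod n))"
      using pos_formD[OF g] by simp
  qed
  then have sum_pos: "pos_form (m * n) (\<lambda>i j. \<Sum>k<m. W k (i div n) * cnj (W k (j div n)) * g (i mod n) (j mod n))"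
    by (intro pos_form_sum)
  have "pos_form (m * n) (\<lambda>i j. \<Sum>k<m. W k (i div n) * cnj (W k (j div n)) * g (i mod n) (j mod n))
    = pos_form (m * n) (\<lambda>i j. f (i div n) (j div n) * g (i mod n) (j mod n))"
    by (rule pos_form_cong) (simp add: W less_mult_imp_div_less sum_distrib_right)
  with sum_pos show ?thesis by simp
qed

lemma pos_form_block:
  assumes f: "pos_form (m * n) f" and a: "a < m"
  shows "pos_form n (\<lambda>b b'. f (a * n + b) (a * n + b'))"
  unfolding pos_form_def
proof
  fix y
  \<comment> \<open>The basis vector \<open>e_a\<close>, in the shape that
    \<open>contract_two\<close> evaluates.\<close>
  define x :: "nat \<Rightarrow> complex" where "x i = of_bool (i = a) * 1 + of_bool (i = a) * 0" for i
  have "contract (m * n) (\<lambda>i. x (i div n) * y (i mod n)) f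
    = contract m x (\<lambda>a a'. contract n y (\<lambda>b b'. f (a * n + b) (a' * n + b')))"
    by (rule contract_tensor) (simp add: div_index)
  also have "\<dots> = contract n y (\<lambda>b b'. f (a * n + b) (a * n + b'))"
    unfolding x_def contract_two[OF a a] by simp
  finally show "0 \<le> contract n y (\<lambda>b b'. f (a * n + b) (a * n + b'))"
    using pos_formD[OF f] by metis
qed

text \<open>Positivity is tested on product vectors with \<open>y\<close> fixed in the second
  factor.\<close>

lemma pos_form_partial_contract:
  assumes f: "pos_form (m * n) f"
  shows "pos_form m (\<lambda>a a'. contract n y (\<lambda>b b'. f (a * n + b) (a' * n + b')))"
  unfolding pos_form_def
proof
  fix x
  have "contract (m * n) (\<lambda>i. x (i div n) * y (i mod n)) f
    = contract m x (\<lambda>a a'. contract n y (\<lambda>b b'. f (a * n + b) (a' * n + b')))"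
    by (rule contract_tensor) (simp add: div_index)
  then show "0 \<le> contract m x (\<lambda>a a'. contract n y (\<lambda>b b'. f (a * n + b) (a' * n + b')))"
    using pos_formD[OF f] by metis
qed

section \<open>Cyclic shifts of tensor factors\<close>

lemma digit_snoc:
  assumes "x < d"
  shows "i < r \<Longrightarrow> digit d (Suc r) (y * d + x) i = digit d r y i"
    and "digit d (Suc r) (y * d + x) r = x"
proof -
  show "digit d (Suc r) (y * d + x) r = x" using assms by (simp add: digit_def)
  assume i: "i < r"
  then have "d ^ (r - i) = d * d ^ (r - 1 - i)"
    by (metis Suc_diff_Suc diff_Suc_1 diff_commute power_Suc)
  then show "digit d (Suc r) (y * d + x) i = digit d r y i"
    using assms by (simp add: digit_def div_mult2_eq div_index)
qed

lemma digit_Cons: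
  assumes "y < d ^ r" "x < d"
  shows "digit d (Suc r) (x * d ^ r + y) 0 = x"
    and "i < r \<Longrightarrow> digit d (Suc r) (x * d ^ r + y) (Suc i) = digit d r y i"
proof -
  show "digit d (Suc r) (x * d ^ r + y) 0 = x"
    using assms by (simp add: digit_def div_index)
  assume i: "i < r"
  let ?e = "d ^ (r - Suc i)"
  have e: "?e \<noteq> 0" using assms by simp
  have "d ^ r = d ^ i * d * ?e"
    using i by (metis Suc_leI le_add_diff_inverse power_Suc2 power_add)
  then have "x * d ^ r + y = (x * d ^ i * d) * ?e + y" by (simp only: mult.assoc)
  then have "(x * d ^ r + y) div ?e = (x * d ^ i) * d + y div ?e"
    using div_mult_self3[OF e, of "x * d ^ i * d" y] by metis
  then show "digit d (Suc r) (x * d ^ r + y) (Suc i) = digit d r y i"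
    by (simp add: digit_def)
qed

lemma digit_inject:
  "x < d ^ r \<Longrightarrow> y < d ^ r \<Longrightarrow> (\<And>i. i < r \<Longrightarrow> digit d r x i = digit d r y i) \<Longrightarrow> x = y"
proof (induction r arbitrary: x y)
  case (Suc r)
  then have d: "d > 0" by (cases d) auto
  have x: "x = (x div d) * d + x mod d" and y: "y = (y div d) * d + y mod d" by simp_all
  have m: "x mod d < d" "y mod d < d" using d by simp_all
  have "x mod d = y mod d"
    using Suc.prems(3)[of r] digit_snoc(2)[OF m(1), of r "x div d"] digit_snoc(2)[OF m(2), of r "y div d"]
    by simp
  moreover have "x div d = y div d"
  proof (rule Suc.IH)
    show "x div d < d ^ r" "y div d < d ^ r"
      using Suc.prems(1,2) by (auto intro!: less_mult_imp_div_less simp: mult.commute)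
    fix i assume i: "i < r"
    show "digit d r (x div d) i = digit d r (y div d) i"
      using Suc.prems(3)[of i] i digit_snoc(1)[OF m(1) i, of "x div d"] digit_snoc(1)[OF m(2) i, of "y div d"]
      by simp
  qed
  ultimately show ?case using x y by metis
qed simp

text \<open>Points above \<open>r\<close> are fixed, as \<open>permutes\<close> demands.\<close>

definition cyclic_shift :: "nat \<Rightarrow> nat \<Rightarrow> nat" where
  "cyclic_shift r i = (if i < r then Suc i else if i = r then 0 else i)"

lemma cyclic_shift_permutes: "cyclic_shift r permutes {..<Suc r}"
proof (rule bij_imp_permutes)
  show "bij_betw (cyclic_shift r) {..<Suc r} {..<Suc r}"
    by (rule bij_betw_byWitness[where f' = "\<lambda>j. case j of 0 \<Rightarrow> r | Suc i \<Rightarrow> i"])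
       (auto simp: cyclic_shift_def split: nat.splits)
qed (auto simp: cyclic_shift_def)

lemma map_cyclic_shift:
  "length ys = r \<Longrightarrow> map (\<lambda>i. (y # ys) ! cyclic_shift r i) [0..<Suc r] = ys @ [y]"
  by (rule nth_equalityI) (auto simp: cyclic_shift_def nth_append less_Suc_eq)

text \<open>The shift carries the last tensor factor to the front. Splitting the row index at its
  leading digit and the column index at its last digit makes the two directly comparable.\<close>

lemma perm_op_cyclic_shift:
  assumes "x < d" "x' < d" "y < d ^ r" "y' < d ^ r"
  shows "perm_op d (Suc r) (cyclic_shift r) $$ (x * d ^ r + y, y' * d + x') = of_bool (x' = x \<and> y' = y)"
proof -
  have "x * d ^ r + y < d ^ Suc r" "y' * d + x' < d ^ Suc r"
    using index_less_mult[OF assms(1,3)] index_less_mult[OF assms(4,2)] by (simp_all add: mult.commute)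
  moreover have "(\<forall>i<Suc r. digit d (Suc r) (y' * d + x') i = digit d (Suc r) (x * d ^ r + y) (cyclic_shift r i))
    \<longleftrightarrow> x' = x \<and> y' = y"
    using assms digit_inject[OF assms(4,3)]
    by (auto simp: All_less_Suc cyclic_shift_def digit_snoc digit_Cons)
  ultimately show ?thesis by (simp add: perm_op_def)
qed

lemma relabel_conjugate_entry:
  assumes M: "M \<in> carrier_mat N N" and A: "A \<in> carrier_mat N N"
    and Mij: "\<And>i j. i < N \<Longrightarrow> j < N \<Longrightarrow> M $$ (i,j) = of_bool (j = \<sigma> i)"
    and \<sigma>: "\<And>i. i < N \<Longrightarrow> \<sigma> i < N" and ij: "i < N" "j < N"
  shows "(M * A * adj M) $$ (i,j) = A $$ (\<sigma> i, \<sigma> j)"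
proof -
  have aM: "adj M \<in> carrier_mat N N" using M by (simp add: adj_def)
  have left: "(M * A) $$ (i,l) = A $$ (\<sigma> i, l)" if "l < N" for l
  proof -
    have "(M * A) $$ (i,l) = (\<Sum>k<N. M $$ (i,k) * A $$ (k,l))"
      using M A ij that by (intro mult_mat_entry) auto
    also have "\<dots> = (\<Sum>k<N. of_bool (k = \<sigma> i) * A $$ (k,l))"
      using Mij ij by (intro sum.cong) auto
    finally show ?thesis using sum_of_bool_mult[of "{..<N}" "\<sigma> i"] \<sigma> ij by simp
  qed
  have "(M * A * adj M) $$ (i,j) = (\<Sum>l<N. (M * A) $$ (i,l) * adj M $$ (l,j))"
    using M A aM ij by (intro mult_mat_entry) auto
  also have "\<dots> = (\<Sum>l<N. of_bool (l = \<sigma> j) * A $$ (\<sigma> i, l))"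
    using M Mij ij by (intro sum.cong refl) (simp add: left adj_def cnj_of_bool mult.commute del: index_mult_mat)
  also have "\<dots> = A $$ (\<sigma> i, \<sigma> j)"
    using \<sigma> ij by (intro sum_of_bool_mult) auto
  finally show ?thesis .
qed

lemma kron_carrier: "M \<in> carrier_mat a a \<Longrightarrow> N \<in> carrier_mat b b \<Longrightarrow> kron M N \<in> carrier_mat (a * b) (a * b)"
  by (auto simp: kron_def)

lemma kron_entry:
  assumes "M \<in> carrier_mat m m" "N \<in> carrier_mat n n" "a < m" "a' < m" "b < n" "b' < n"
  shows "kron M N $$ (a * n + b, a' * n + b') = M $$ (a,a') * N $$ (b,b')"
  using assms index_less_mult[of a m b n] index_less_mult[of a' m b' n]
  by (simp add: kron_def div_index)

lemma cyclic_shift_conjugate_entry: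
  assumes A: "A \<in> carrier_mat (n * d ^ Suc r) (n * d ^ Suc r)"
    and "a < n" "x < d" "y < d ^ r" "a' < n" "x' < d" "y' < d ^ r"
  defines "M \<equiv> kron (1\<^sub>m n) (perm_op d (Suc r) (cyclic_shift r))"
  shows "(M * A * adj M) $$ ((a * d + x) * d ^ r + y, (a' * d + x') * d ^ r + y')
    = A $$ ((a * d ^ r + y) * d + x, (a' * d ^ r + y') * d + x')"
proof -
  let ?D = "d ^ Suc r" and ?W = "perm_op d (Suc r) (cyclic_shift r)"
  \<comment> \<open>\<open>\<tau>\<close> moves the leading digit of an index of the
    \<open>B\<close> systems to the end; \<open>\<sigma>\<close> does this with the \<open>A\<close>
    index fixed. The operator \<open>M\<close> is the permutation matrix of
    \<open>\<sigma>\<close>.\<close>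
  define \<tau> where "\<tau> c = (c mod d ^ r) * d + c div d ^ r" for c
  define \<sigma> where "\<sigma> i = (i div ?D) * ?D + \<tau> (i mod ?D)" for i
  have d: "d > 0" using assms by simp
  have W: "?W \<in> carrier_mat ?D ?D" by (simp add: perm_op_def)
  have \<tau>: "\<tau> c < ?D" if "c < ?D" for c
    using index_less_mult[of "c mod d ^ r" "d ^ r" "c div d ^ r" d] that d
    by (simp add: \<tau>_def less_mult_imp_div_less mult.commute)
  have Wcb: "?W $$ (c,b) = of_bool (b = \<tau> c)" if "c < ?D" "b < ?D" for c b
  proof -
    have lt: "c div d ^ r < d" "b mod d < d" "c mod d ^ r < d ^ r" "b div d < d ^ r"
      using that d by (auto simp: less_mult_imp_div_less mult.commute)
    have "?W $$ ((c div d ^ r) * d ^ r + c mod d ^ r, (b div d) * d + b mod d)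
      = of_bool (b mod d = c div d ^ r \<and> b div d = c mod d ^ r)"
      by (rule perm_op_cyclic_shift[OF lt])
    then have "?W $$ (c,b) = of_bool (b mod d = c div d ^ r \<and> b div d = c mod d ^ r)"
      by (simp only: div_mult_mod_eq)
    moreover have "b = \<tau> c \<longleftrightarrow> b mod d = c div d ^ r \<and> b div d = c mod d ^ r"
    proof
      assume "b = \<tau> c"
      then show "b mod d = c div d ^ r \<and> b div d = c mod d ^ r"
        unfolding \<tau>_def using lt(1) div_index[OF lt(1), of "c mod d ^ r"] by simp
    next
      assume "b mod d = c div d ^ r \<and> b div d = c mod d ^ r"
      then show "b = \<tau> c" unfolding \<tau>_def using div_mult_mod_eq[of b d] by simp
    qed
    ultimately show ?thesis by simp
  qed
  have Mij: "M $$ (i,j) = of_bool (j = \<sigma> i)" if ij: "i < n * ?D" "j < n * ?D" for i j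
  proof -
    have D: "?D > 0" using d by simp
    have lt: "i div ?D < n" "j div ?D < n" "i mod ?D < ?D" "j mod ?D < ?D"
      using ij D by (auto simp only: less_mult_imp_div_less mod_less_divisor)
    have "M $$ ((i div ?D) * ?D + i mod ?D, (j div ?D) * ?D + j mod ?D)
      = of_bool (i div ?D = j div ?D) * of_bool (j mod ?D = \<tau> (i mod ?D))"
      unfolding M_def kron_entry[OF one_carrier_mat W lt] Wcb[OF lt(3,4)] using lt by simp
    then have "M $$ (i,j) = of_bool (i div ?D = j div ?D) * of_bool (j mod ?D = \<tau> (i mod ?D))"
      by (simp only: div_mult_mod_eq)
    moreover have "j = \<sigma> i \<longleftrightarrow> i div ?D = j div ?D \<and> j mod ?D = \<tau> (i mod ?D)"
    proof
      assume "j = \<sigma> i"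
      then show "i div ?D = j div ?D \<and> j mod ?D = \<tau> (i mod ?D)"
        unfolding \<sigma>_def using \<tau>[OF lt(3)] div_index[OF \<tau>[OF lt(3)], of "i div ?D"]
        by (metis mod_less mod_mult_self3)
    next
      assume "i div ?D = j div ?D \<and> j mod ?D = \<tau> (i mod ?D)"
      then show "j = \<sigma> i" unfolding \<sigma>_def using div_mult_mod_eq[of j ?D] by simp
    qed
    ultimately show ?thesis by simp
  qed
  have \<sigma>: "\<sigma> i < n * ?D" if "i < n * ?D" for i
    unfolding \<sigma>_def using that d by (intro index_less_mult \<tau>) (auto simp: less_mult_imp_div_less)
  have M: "M \<in> carrier_mat (n * ?D) (n * ?D)"
    unfolding M_def by (rule kron_carrier) (simp_all add: perm_op_def)
  have idx: "(a * d + x) * d ^ r + y < n * ?D \<and> \<sigma> ((a * d + x) * d ^ r + y) = (a * d ^ r + y) * d + x"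
    if "a < n" "x < d" "y < d ^ r" for a x y
  proof -
    have e: "(a * d + x) * d ^ r + y = a * ?D + (x * d ^ r + y)" by (simp add: algebra_simps)
    have l: "x * d ^ r + y < ?D" using index_less_mult[OF that(2,3)] by simp
    have "\<sigma> (a * ?D + (x * d ^ r + y)) = a * ?D + \<tau> (x * d ^ r + y)"
      unfolding \<sigma>_def using div_index[OF l, of a] l by (metis mod_less mod_mult_self3)
    also have "\<tau> (x * d ^ r + y) = y * d + x"
      unfolding \<tau>_def using div_index[OF that(3), of x] that(3) by simp
    finally show ?thesis
      unfolding e using index_less_mult[OF that(1) l] by (simp add: algebra_simps)
  qed
  show ?thesis
    using relabel_conjugate_entry[OF M A Mij \<sigma>] idx assms by metis
qed

section \<open>Extendible measurements\<close>

lemma msum_entry: "i < n \<Longrightarrow> j < n \<Longrightarrow> msum n S f $$ (i,j) = (\<Sum>s\<in>S. f s $$ (i,j))"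
  by (simp add: msum_def)

lemma words_UNIV: "words UNIV r = {l. length l = r}"
  by (auto simp: words_def)

text \<open>Here \<open>n = |A|\<close>, \<open>d = |B|\<close> and \<open>k = Suc r\<close>, so
  that \<open>r\<close> systems remain once \<open>B_1\<close> or the last one is split off.\<close>

locale povm_extension =
  fixes n d r :: nat and P :: "'y::finite \<Rightarrow> complex mat" and G :: "'y list \<Rightarrow> complex mat"
  assumes d: "d > 0"
    and P_povm: "is_povm (n * d) UNIV P"
    and G_povm: "is_povm (n * d ^ Suc r) {ys. length ys = Suc r} G"
    and marginal: "\<And>y. msum (n * d ^ Suc r) {zs. length zs = r} (\<lambda>zs. G (y # zs)) = kron (P y) (1\<^sub>m (d ^ r))"
    and no_signalling: "\<And>ys. length ys = r \<Longrightarrow>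
      (let S = msum (n * d ^ Suc r) UNIV (\<lambda>y. G (ys @ [y])) in
        ptrace_left n (d ^ Suc r) S =
        (1 / of_nat d) \<cdot>\<^sub>m kron (ptrace_left n (d ^ r) (ptrace_right (n * d ^ r) d S)) (1\<^sub>m d))"
    and symmetric: "\<And>ys \<pi>. length ys = Suc r \<Longrightarrow> \<pi> permutes {..<Suc r} \<Longrightarrow>
      kron (1\<^sub>m n) (perm_op d (Suc r) \<pi>) * G (map (\<lambda>i. ys ! \<pi> i) [0..<Suc r])
        * adj (kron (1\<^sub>m n) (perm_op d (Suc r) \<pi>)) = G ys"
begin

section \<open>The conditions on the extension in terms of entries\<close>

lemma G_carrier: "length ys = Suc r \<Longrightarrow> G ys \<in> carrier_mat (n * d ^ Suc r) (n * d ^ Suc r)"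
  and G_pos: "length ys = Suc r \<Longrightarrow> pos_form (n * d ^ Suc r) (\<lambda>i j. G ys $$ (i,j))"
  using G_povm by (auto simp: is_povm_def psd_iff_pos_form)

lemma P_carrier: "P y \<in> carrier_mat (n * d) (n * d)"
  using P_povm by (auto simp: is_povm_def psd_iff_pos_form)

lemma P_sum: "i < n * d \<Longrightarrow> j < n * d \<Longrightarrow> (\<Sum>y\<in>UNIV. P y $$ (i,j)) = of_bool (i = j)"
  using P_povm msum_entry[of i "n * d" j UNIV P] by (cases "i = j") (auto simp: is_povm_def)

lemma G_marginal:
  assumes "i < n * d" "j < n * d" "x < d ^ r" "x' < d ^ r"
  shows "(\<Sum>ys\<in>words UNIV r. G (y # ys) $$ (i * d ^ r + x, j * d ^ r + x')) = P y $$ (i,j) * of_bool (x = x')"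
proof -
  have N: "n * d ^ Suc r = (n * d) * d ^ r" by simp
  have "(\<Sum>ys\<in>words UNIV r. G (y # ys) $$ (i * d ^ r + x, j * d ^ r + x'))
    = msum (n * d ^ Suc r) {zs. length zs = r} (\<lambda>zs. G (y # zs)) $$ (i * d ^ r + x, j * d ^ r + x')"
    unfolding words_UNIV N
    by (rule msum_entry[symmetric]; rule index_less_mult) (use assms in auto)
  also have "\<dots> = P y $$ (i,j) * of_bool (x = x')"
    unfolding marginal kron_entry[OF P_carrier one_carrier_mat assms] using assms by simp
  finally show ?thesis .
qed

text \<open>Condition (i) singles out the first system, condition (ii) the last; this shift lets
  both be applied to the same system.\<close>

lemma G_rotate:
  assumes "length ys = r" "a < n" "x < d" "b < d ^ r" "a' < n" "x' < d" "b' < d ^ r"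
  shows "G (y # ys) $$ ((a * d + x) * d ^ r + b, (a' * d + x') * d ^ r + b')
    = G (ys @ [y]) $$ ((a * d ^ r + b) * d + x, (a' * d ^ r + b') * d + x')"
  using symmetric[of "y # ys" "cyclic_shift r", OF _ cyclic_shift_permutes] map_cyclic_shift[OF assms(1), of y]
    cyclic_shift_conjugate_entry[OF G_carrier[of "ys @ [y]"] assms(2-7)] assms(1)
  by simp

text \<open>Only proportionality to the identity on the last system is kept here. The factor is
  determined later, in \<open>joint_marginal_no_signalling\<close>.\<close>

lemma G_no_signalling:
  assumes "length ys = r"
  obtains Q where "\<And>b b' x x'. b < d ^ r \<Longrightarrow> b' < d ^ r \<Longrightarrow> x < d \<Longrightarrow> x' < d \<Longrightarrow>
    (\<Sum>y\<in>UNIV. \<Sum>a<n. G (ys @ [y]) $$ ((a * d ^ r + b) * d + x, (a * d ^ r + b') * d + x'))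
      = Q b b' * of_bool (x = x')"
proof -
  let ?D = "d ^ Suc r"
  define S where "S = msum (n * ?D) UNIV (\<lambda>y. G (ys @ [y]))"
  define R where "R = ptrace_left n (d ^ r) (ptrace_right (n * d ^ r) d S)"
  have R: "R \<in> carrier_mat (d ^ r) (d ^ r)" by (simp add: R_def ptrace_left_def)
  have eq: "ptrace_left n ?D S = (1 / of_nat d) \<cdot>\<^sub>m kron R (1\<^sub>m d)"
    using no_signalling[OF assms] by (simp add: S_def R_def Let_def)
  have "(\<Sum>y\<in>UNIV. \<Sum>a<n. G (ys @ [y]) $$ ((a * d ^ r + b) * d + x, (a * d ^ r + b') * d + x'))
      = 1 / of_nat d * R $$ (b,b') * of_bool (x = x')"
    if lt: "b < d ^ r" "b' < d ^ r" "x < d" "x' < d" for b b' x x'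
  proof -
    have i: "b * d + x < ?D" "b' * d + x' < ?D"
      using index_less_mult[OF lt(1,3)] index_less_mult[OF lt(2,4)] by (simp_all add: mult.commute)
    have e: "(a * d ^ r + b) * d + x = a * ?D + (b * d + x)" for a b x by (simp add: algebra_simps)
    have "(\<Sum>y\<in>UNIV. \<Sum>a<n. G (ys @ [y]) $$ ((a * d ^ r + b) * d + x, (a * d ^ r + b') * d + x'))
      = (\<Sum>a<n. S $$ (a * ?D + (b * d + x), a * ?D + (b' * d + x')))"
      unfolding e S_def
      by (subst sum.swap) (intro sum.cong refl msum_entry[symmetric] index_less_mult i; simp)
    also have "\<dots> = ptrace_left n ?D S $$ (b * d + x, b' * d + x')"
      using i by (simp add: ptrace_left_def del: power_Suc)
    also have "\<dots> = 1 / of_nat d * (kron R (1\<^sub>m d) $$ (b * d + x, b' * d + x'))"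
      unfolding eq using i kron_carrier[OF R one_carrier_mat[of d]] by (simp add: mult.commute)
    finally show ?thesis unfolding kron_entry[OF R one_carrier_mat lt] using lt by simp
  qed
  then show ?thesis by (rule that)
qed

section \<open>Operators conditioned on complete records\<close>

abbreviation records :: "((nat \<times> nat \<times> nat) \<times> 'y) set" where "records \<equiv> settings d \<times> UNIV"

text \<open>The operator on \<open>A\<close> for a full record, and the operator on \<open>A B\<^sub>1\<close> for an outcome \<open>y\<close> of \<open>B\<^sub>1\<close> and
  a record of the other systems. Probe amplitudes are unnormalised: the probability of choosing
  a probe is contained in them.\<close>

definition outcome_op :: "((nat \<times> nat \<times> nat) \<times> 'y) list \<Rightarrow> nat \<Rightarrow> nat \<Rightarrow> complex" where
  "outcome_op l a a' = contract (d ^ Suc r) (probe_product d (map fst l))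
     (\<lambda>x x'. G (map snd l) $$ (a * d ^ Suc r + x, a' * d ^ Suc r + x'))"

definition joint_op :: "'y \<Rightarrow> ((nat \<times> nat \<times> nat) \<times> 'y) list \<Rightarrow> nat \<Rightarrow> nat \<Rightarrow> complex" where
  "joint_op y l i j = contract (d ^ r) (probe_product d (map fst l))
     (\<lambda>x x'. G (y # map snd l) $$ (i * d ^ r + x, j * d ^ r + x'))"

lemma outcome_op_Cons:
  assumes "length l = r"
  shows "outcome_op ((z,y) # l) a a' = contract d (probe d z) (\<lambda>b b'. joint_op y l (a * d + b) (a' * d + b'))"
proof -
  have e: "a * d ^ Suc r + (b * d ^ r + x) = (a * d + b) * d ^ r + x" for a b x
    by (simp add: algebra_simps)
  have "outcome_op ((z,y) # l) a a' = contract (d * d ^ r) (probe_product d (z # map fst l))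
     (\<lambda>x x'. G (y # map snd l) $$ (a * d ^ Suc r + x, a' * d ^ Suc r + x'))"
    by (simp add: outcome_op_def)
  also have "\<dots> = contract d (probe d z) (\<lambda>b b'. contract (d ^ r) (probe_product d (map fst l))
      (\<lambda>x x'. G (y # map snd l) $$ (a * d ^ Suc r + (b * d ^ r + x), a' * d ^ Suc r + (b' * d ^ r + x'))))"
    by (rule contract_tensor) (use probe_product_Cons_index[of _ d "map fst l" z] assms in simp)
  finally show ?thesis unfolding e joint_op_def .
qed

lemma outcome_op_snoc:
  assumes "length l = r"
  shows "outcome_op (l @ [(z,y)]) a a' = contract (d ^ r) (probe_product d (map fst l)) (\<lambda>x x'.
    contract d (probe d z) (\<lambda>b b'. G (map snd l @ [y]) $$ ((a * d ^ r + x) * d + b, (a' * d ^ r + x') * d + b')))"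
proof -
  have e: "a * d ^ Suc r + (x * d + b) = (a * d ^ r + x) * d + b" for a b x
    by (simp add: algebra_simps)
  have "outcome_op (l @ [(z,y)]) a a' = contract (d ^ r * d) (probe_product d (map fst l @ [z]))
     (\<lambda>x x'. G (map snd l @ [y]) $$ (a * d ^ Suc r + x, a' * d ^ Suc r + x'))"
    by (simp add: outcome_op_def mult.commute)
  also have "\<dots> = contract (d ^ r) (probe_product d (map fst l)) (\<lambda>x x'. contract d (probe d z)
      (\<lambda>b b'. G (map snd l @ [y]) $$ (a * d ^ Suc r + (x * d + b), a' * d ^ Suc r + (x' * d + b'))))"
    by (rule contract_tensor) (use probe_product_snoc_index[of _ d _ "map fst l" z] assms in simp)
  finally show ?thesis unfolding e .
qed

text \<open>The martingale adds records at the head, while marginals sum over records at the end;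
  this reconciles the two. The probes of the shifted system and of the others are contracted in
  either order.\<close>

lemma outcome_op_rotate:
  assumes "length l = r" "a < n" "a' < n"
  shows "outcome_op (s # l) a a' = outcome_op (l @ [s]) a a'"
proof -
  obtain z y where s: "s = (z,y)" by (cases s)
  show ?thesis
    unfolding s outcome_op_Cons[OF assms(1)] outcome_op_snoc[OF assms(1)] joint_op_def
    by (subst contract_swap) (intro contract_cong G_rotate, use assms in auto)
qed

lemma joint_op_pos: "length l = r \<Longrightarrow> pos_form (n * d) (joint_op y l)"
  unfolding joint_op_def using G_pos[of "y # map snd l"]
  by (intro pos_form_partial_contract) (simp add: mult.assoc)

lemma outcome_op_pos: "length l = Suc r \<Longrightarrow> pos_form n (outcome_op l)"
  unfolding outcome_op_def using G_pos[of "map snd l"] by (intro pos_form_partial_contract) simp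

text \<open>Condition (ii) after rotating \<open>B_1\<close> to the end. The common diagonal value
  is read off at \<open>b = 0\<close>.\<close>

lemma joint_op_no_signalling:
  assumes l: "length l = r" and "b < d" "b' < d"
  shows "(\<Sum>y\<in>UNIV. \<Sum>a<n. joint_op y l (a * d + b) (a * d + b'))
    = of_bool (b = b') * (\<Sum>y\<in>UNIV. \<Sum>a<n. joint_op y l (a * d) (a * d))"
proof -
  obtain Q where Q: "\<And>b b' x x'. b < d ^ r \<Longrightarrow> b' < d ^ r \<Longrightarrow> x < d \<Longrightarrow> x' < d \<Longrightarrow>
    (\<Sum>y\<in>UNIV. \<Sum>a<n. G (map snd l @ [y]) $$ ((a * d ^ r + b) * d + x, (a * d ^ r + b') * d + x'))
      = Q b b' * of_bool (x = x')"
    using G_no_signalling[of "map snd l"] l by auto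
  have "(\<Sum>y\<in>UNIV. \<Sum>a<n. joint_op y l (a * d + b) (a * d + b'))
    = contract (d ^ r) (probe_product d (map fst l)) Q * of_bool (b = b')" if b: "b < d" "b' < d" for b b'
  proof -
    have "(\<Sum>y\<in>UNIV. \<Sum>a<n. joint_op y l (a * d + b) (a * d + b'))
      = contract (d ^ r) (probe_product d (map fst l)) (\<lambda>x x'. \<Sum>y\<in>UNIV. \<Sum>a<n.
          G (y # map snd l) $$ ((a * d + b) * d ^ r + x, (a * d + b') * d ^ r + x'))"
      by (simp only: contract_sum joint_op_def)
    also have "\<dots> = contract (d ^ r) (probe_product d (map fst l)) (\<lambda>x x'. of_bool (b = b') * Q x x')"
    proof (rule contract_cong)
      fix x x' assume x: "x < d ^ r" "x' < d ^ r"
      have "(\<Sum>y\<in>UNIV. \<Sum>a<n. G (y # map snd l) $$ ((a * d + b) * d ^ r + x, (a * d + b') * d ^ r + x'))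
        = (\<Sum>y\<in>UNIV. \<Sum>a<n. G (map snd l @ [y]) $$ ((a * d ^ r + x) * d + b, (a * d ^ r + x') * d + b'))"
        using l x b by (intro sum.cong refl G_rotate) auto
      then show "(\<Sum>y\<in>UNIV. \<Sum>a<n. G (y # map snd l) $$ ((a * d + b) * d ^ r + x, (a * d + b') * d ^ r + x'))
        = of_bool (b = b') * Q x x'" using Q[OF x b] by simp
    qed
    finally show ?thesis by (simp add: contract_scale)
  qed
  from this[OF assms(2,3)] this[OF d d] show ?thesis by simp
qed

section \<open>Partial records and their marginals\<close>

definition joint_marginal :: "'y \<Rightarrow> ((nat \<times> nat \<times> nat) \<times> 'y) list \<Rightarrow> nat \<Rightarrow> nat \<Rightarrow> complex" where
  "joint_marginal y l i j = (\<Sum>l'\<in>words records (r - length l). joint_op y (l @ l') i j)"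

text \<open>The operator \<open>h_l\<close> of the overview, with the results of the later systems
  discarded. Here \<open>l\<close> starts at \<open>B_1\<close>, whereas in
  \<open>joint_marginal\<close> it starts at \<open>B_2\<close>; hence \<open>Suc r\<close> against
  \<open>r\<close>.\<close>

definition outcome_marginal :: "((nat \<times> nat \<times> nat) \<times> 'y) list \<Rightarrow> nat \<Rightarrow> nat \<Rightarrow> complex" where
  "outcome_marginal l a a' = (\<Sum>l'\<in>words records (Suc r - length l). outcome_op (l @ l') a a')"

definition outcome_weight :: "((nat \<times> nat \<times> nat) \<times> 'y) list \<Rightarrow> real" where
  "outcome_weight l = Re (\<Sum>a<n. outcome_marginal l a a)"

lemma joint_marginal_pos: "length l \<le> r \<Longrightarrow> pos_form (n * d) (joint_marginal y l)"
  unfolding joint_marginal_def by (intro pos_form_sum joint_op_pos) (auto simp: words_def)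

lemma outcome_marginal_pos: "length l \<le> Suc r \<Longrightarrow> pos_form n (outcome_marginal l)"
  unfolding outcome_marginal_def by (intro pos_form_sum outcome_op_pos) (auto simp: words_def)

lemma trace_outcome_marginal: "length l \<le> Suc r \<Longrightarrow> (\<Sum>a<n. outcome_marginal l a a) = of_real (outcome_weight l)"
  using pos_form_diag[OF outcome_marginal_pos] by (auto simp: outcome_weight_def complex_eq_iff less_eq_complex_def)

text \<open>The link between the martingale and the operators on \<open>A B\<close>: observing one
  more system is probing the \<open>B\<close> factor of the joint operator.\<close>

lemma outcome_marginal_Cons:
  assumes "length l \<le> r"
  shows "outcome_marginal ((z,y) # l) a a' = contract d (probe d z) (\<lambda>b b'. joint_marginal y l (a * d + b) (a' * d + b'))"
proof -
  have "outcome_marginal ((z,y) # l) a a' = (\<Sum>l'\<in>words records (r - length l). outcome_op ((z,y) # l @ l') a a')"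
    by (simp add: outcome_marginal_def)
  also have "\<dots> = (\<Sum>l'\<in>words records (r - length l).
      contract d (probe d z) (\<lambda>b b'. joint_op y (l @ l') (a * d + b) (a' * d + b')))"
    using assms by (intro sum.cong refl outcome_op_Cons) (auto simp: words_def)
  finally show ?thesis by (simp only: contract_sum joint_marginal_def)
qed

text \<open>The martingale property. A summed head record is rotated to the end, where it joins the
  discarded ones.\<close>

lemma sum_outcome_marginal_Cons:
  assumes "length l \<le> r" "a < n" "a' < n"
  shows "(\<Sum>s\<in>records. outcome_marginal (s # l) a a') = outcome_marginal l a a'"
proof -
  have "(\<Sum>s\<in>records. outcome_marginal (s # l) a a') = (\<Sum>s\<in>records. \<Sum>l'\<in>words records (r - length l). outcome_op (s # (l @ l')) a a')"
    by (simp add: outcome_marginal_def)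
  also have "\<dots> = (\<Sum>s\<in>records. \<Sum>l'\<in>words records (r - length l). outcome_op ((l @ l') @ [s]) a a')"
    using assms by (intro sum.cong refl outcome_op_rotate) (auto simp: words_def)
  also have "\<dots> = (\<Sum>l'\<in>words records (Suc (r - length l)). outcome_op (l @ l') a a')"
    unfolding sum_words_snoc by (subst sum.swap) simp
  finally show ?thesis using assms by (simp add: outcome_marginal_def Suc_diff_le)
qed

lemma outcome_marginal_eq_ptrace:
  assumes "length l \<le> r" "a < n" "a' < n"
  shows "outcome_marginal l a a' = (\<Sum>y\<in>UNIV. (\<Sum>b<d. joint_marginal y l (a * d + b) (a' * d + b)) / of_nat d)"
proof -
  have "outcome_marginal l a a' = (\<Sum>y\<in>UNIV. \<Sum>z\<in>settings d. outcome_marginal ((z,y) # l) a a')"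
    unfolding sum_outcome_marginal_Cons[OF assms, symmetric]
    by (subst sum.swap) (simp add: sum.cartesian_product case_prod_unfold)
  also have "\<dots> = (\<Sum>y\<in>UNIV. (\<Sum>b<d. joint_marginal y l (a * d + b) (a' * d + b)) / of_nat d)"
    unfolding outcome_marginal_Cons[OF assms(1)] by (intro sum.cong refl sum_contract_complete probe_complete)
  finally show ?thesis .
qed

text \<open>By condition (ii) the sum is a constant \<open>c\<close> times the identity on
  \<open>B\<close>. Tracing over \<open>B\<close> and dividing by \<open>d\<close> gives both
  \<open>c\<close> and, by \<open>outcome_marginal_eq_ptrace\<close>, the weight.\<close>

lemma joint_marginal_no_signalling:
  assumes l: "length l \<le> r" and b: "b < d" "b' < d"
  shows "(\<Sum>y\<in>UNIV. \<Sum>a<n. joint_marginal y l (a * d + b) (a * d + b')) = of_bool (b = b') * of_real (outcome_weight l)"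
proof -
  define c where "c = (\<Sum>l'\<in>words records (r - length l). \<Sum>y\<in>UNIV. \<Sum>a<n. joint_op y (l @ l') (a * d) (a * d))"
  have Q: "(\<Sum>y\<in>UNIV. \<Sum>a<n. joint_marginal y l (a * d + b) (a * d + b')) = of_bool (b = b') * c"
    if b: "b < d" "b' < d" for b b'
  proof -
    have "(\<Sum>y\<in>UNIV. \<Sum>a<n. joint_marginal y l (a * d + b) (a * d + b'))
      = (\<Sum>y\<in>UNIV. \<Sum>l'\<in>words records (r - length l). \<Sum>a<n. joint_op y (l @ l') (a * d + b) (a * d + b'))"
      unfolding joint_marginal_def by (rule sum.cong[OF refl]) (rule sum.swap)
    also have "\<dots> = (\<Sum>l'\<in>words records (r - length l). \<Sum>y\<in>UNIV. \<Sum>a<n. joint_op y (l @ l') (a * d + b) (a * d + b'))"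
      by (rule sum.swap)
    also have "\<dots> = of_bool (b = b') * c"
      unfolding c_def sum_distrib_left[of _ _ "words records _"]
      by (intro sum.cong[OF refl] joint_op_no_signalling) (use l b in \<open>auto simp: words_def\<close>)
    finally show ?thesis .
  qed
  have "of_real (outcome_weight l) = (\<Sum>a<n. \<Sum>y\<in>UNIV. (\<Sum>b<d. joint_marginal y l (a * d + b) (a * d + b)) / of_nat d)"
    unfolding trace_outcome_marginal[symmetric, OF le_SucI[OF l]] by (intro sum.cong refl outcome_marginal_eq_ptrace l) auto
  also have "\<dots> = (\<Sum>y\<in>UNIV. \<Sum>a<n. \<Sum>b<d. joint_marginal y l (a * d + b) (a * d + b)) / of_nat d"
    by (subst sum.swap) (simp add: sum_divide_distrib)
  also have "\<dots> = (\<Sum>b<d. \<Sum>y\<in>UNIV. \<Sum>a<n. joint_marginal y l (a * d + b) (a * d + b)) / of_nat d"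
    by (subst (2) sum.swap) (subst sum.swap, rule refl)
  also have "\<dots> = c" using Q d by simp
  finally show ?thesis using Q[OF b] by simp
qed

text \<open>Summing over outcomes leaves \<open>P y\<close> tensored with the identity by condition
  (i); the trace \<open>d ^ r\<close> of that identity cancels the normalisation of the probes. This
  holds at every level \<open>m\<close>, so the level can be chosen afterwards.\<close>

lemma sum_joint_marginal:
  assumes "m \<le> r" "i < n * d" "j < n * d"
  shows "(\<Sum>l\<in>words records m. joint_marginal y l i j) = P y $$ (i,j)"
proof -
  have "(\<Sum>l\<in>words records m. joint_marginal y l i j) = (\<Sum>l\<in>words records m. \<Sum>l'\<in>words records (r - m). joint_op y (l @ l') i j)"
    by (intro sum.cong refl) (simp add: joint_marginal_def words_def)
  also have "\<dots> = (\<Sum>l\<in>words records r. joint_op y l i j)"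
    using assms(1) sum_words_append[of "\<lambda>l. joint_op y l i j" records m "r - m"] by simp
  also have "\<dots> = (\<Sum>zs\<in>words (settings d) r. \<Sum>ys\<in>words UNIV r. contract (d ^ r) (probe_product d zs)
     (\<lambda>x x'. G (y # ys) $$ (i * d ^ r + x, j * d ^ r + x')))"
    unfolding joint_op_def by (rule sum_words_times)
  also have "\<dots> = (\<Sum>zs\<in>words (settings d) r. contract (d ^ r) (probe_product d zs)
     (\<lambda>x x'. \<Sum>ys\<in>words UNIV r. G (y # ys) $$ (i * d ^ r + x, j * d ^ r + x')))"
    by (simp only: contract_sum)
  also have "\<dots> = (\<Sum>x<d ^ r. \<Sum>ys\<in>words UNIV r. G (y # ys) $$ (i * d ^ r + x, j * d ^ r + x)) / of_nat d ^ r"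
    by (intro sum_contract_complete probe_product_complete)
  also have "\<dots> = P y $$ (i,j)"
    using assms d by (simp add: G_marginal)
  finally show ?thesis .
qed

text \<open>So the \<open>h_l\<close> at a fixed level form a POVM on \<open>A\<close>: they come
  from the operators on \<open>A B\<close> by the normalised trace over \<open>B\<close>, and these
  sum to \<open>P\<close>.\<close>

lemma sum_outcome_marginal:
  assumes "m \<le> r" "a < n" "a' < n"
  shows "(\<Sum>l\<in>words records m. outcome_marginal l a a') = of_bool (a = a')"
proof -
  have "(\<Sum>l\<in>words records m. outcome_marginal l a a')
    = (\<Sum>l\<in>words records m. \<Sum>y\<in>UNIV. (\<Sum>b<d. joint_marginal y l (a * d + b) (a' * d + b)) / of_nat d)"
    using assms by (intro sum.cong refl outcome_marginal_eq_ptrace) (auto simp: words_def)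
  also have "\<dots> = (\<Sum>b<d. \<Sum>y\<in>UNIV. \<Sum>l\<in>words records m. joint_marginal y l (a * d + b) (a' * d + b)) / of_nat d"
    by (simp only: sum_divide_distrib[symmetric])
       (subst sum.swap, subst (2) sum.swap, subst sum.swap, rule refl)
  also have "\<dots> = (\<Sum>b<d. of_bool (a * d + b = a' * d + b)) / of_nat d"
    using assms by (simp add: sum_joint_marginal P_sum index_less_mult)
  also have "\<dots> = of_bool (a = a')" using d by (cases "a = a'") auto
  finally show ?thesis .
qed

end

section \<open>Norm estimates for the inverted tomography\<close>

lemma L2_set_sum: "L2_set (\<lambda>i. \<Sum>x\<in>X. f x i) A \<le> (\<Sum>x\<in>X. L2_set (f x) A)"
proof (induction X rule: infinite_finite_induct)
  case (insert x X)
  have "L2_set (\<lambda>i. f x i + (\<Sum>x\<in>X. f x i)) A \<le> L2_set (f x) A + L2_set (\<lambda>i. \<Sum>x\<in>X. f x i) A"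
    by (rule L2_set_triangle_ineq)
  with insert show ?case by simp
qed (simp_all add: L2_set_def)

lemma L2_set_times_le_sum: "L2_set (\<lambda>(p,x). f p x) (A \<times> B) \<le> (\<Sum>p\<in>A. L2_set (f p) B)"
proof -
  have "L2_set (\<lambda>(p,x). f p x) (A \<times> B) = L2_set (\<lambda>p. L2_set (f p) B) A"
    by (simp add: L2_set_def sum_nonneg sum.cartesian_product case_prod_unfold)
  also have "\<dots> \<le> (\<Sum>p\<in>A. L2_set (f p) B)" by (rule L2_set_le_sum) simp
  finally show ?thesis .
qed

text \<open>The operator is cut into blocks on \<open>A\<close>, one for each pair
  \<open>(p,q)\<close> of indices of \<open>B\<close>. By \<open>entry_from_contract_probe\<close> a
  block is \<open>2 d^2\<close> times a combination of four probed operators with coefficients of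
  modulus 1; the triangle inequality does the rest.\<close>

lemma hilbert_schmidt_le_tomography:
  "L2_set (\<lambda>(i,j). cmod (f i j)) ({..<n * d} \<times> {..<n * d}) \<le> 2 * real d ^ 2 * (\<Sum>z\<in>settings d.
    L2_set (\<lambda>(a,a'). cmod (contract d (probe d z) (\<lambda>b b'. f (a * d + b) (a' * d + b')))) ({..<n} \<times> {..<n}))"
proof -
  let ?J = "{..<n} \<times> {..<n}"
  let ?g = "\<lambda>z (a,a'). cmod (contract d (probe d z) (\<lambda>b b'. f (a * d + b) (a' * d + b')))"
  have "(\<Sum>a<n. \<Sum>b<d. \<Sum>a'<n. \<Sum>b'<d. (cmod (f (a * d + b) (a' * d + b')))\<^sup>2)
    = (\<Sum>b<d. \<Sum>a<n. \<Sum>b'<d. \<Sum>a'<n. (cmod (f (a * d + b) (a' * d + b')))\<^sup>2)"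
    by (subst sum.swap) (intro sum.cong[OF refl] sum.swap)
  also have "\<dots> = (\<Sum>b<d. \<Sum>b'<d. \<Sum>a<n. \<Sum>a'<n. (cmod (f (a * d + b) (a' * d + b')))\<^sup>2)"
    by (rule sum.cong[OF refl]) (rule sum.swap)
  finally have "L2_set (\<lambda>(i,j). cmod (f i j)) ({..<n * d} \<times> {..<n * d})
    = L2_set (\<lambda>(p,x). cmod (f (fst x * d + fst p) (snd x * d + snd p))) (({..<d} \<times> {..<d}) \<times> ?J)"
    by (simp only: L2_set_def case_prod_unfold sum.cartesian_product' fst_conv snd_conv sum_lessThan_mult)
  also have "\<dots> \<le> (\<Sum>p\<in>{..<d} \<times> {..<d}. L2_set (\<lambda>x. cmod (f (fst x * d + fst p) (snd x * d + snd p))) ?J)"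
    by (rule L2_set_times_le_sum)
  also have "\<dots> \<le> (\<Sum>p\<in>{..<d} \<times> {..<d}. 2 * real d ^ 2 * (\<Sum>s<4. L2_set (?g (fst p, snd p, s)) ?J))"
  proof (rule sum_mono)
    fix p assume "p \<in> {..<d} \<times> {..<d}"
    then have p: "fst p < d" "snd p < d" by auto
    have "cmod (f (fst x * d + fst p) (snd x * d + snd p)) \<le> 2 * real d ^ 2 * (\<Sum>s<4. ?g (fst p, snd p, s) x)" for x
    proof -
      let ?c = "\<lambda>s. contract d (probe d (fst p, snd p, s)) (\<lambda>b b'. f (fst x * d + b) (snd x * d + b'))"
      have "cmod (f (fst x * d + fst p) (snd x * d + snd p))
        = cmod (2 * of_nat d ^ 2 * (\<Sum>s<4. (-\<i>) ^ s * ?c s))"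
        using entry_from_contract_probe[OF p, of "\<lambda>b b'. f (fst x * d + b) (snd x * d + b')"] by simp
      also have "\<dots> = 2 * real d ^ 2 * cmod (\<Sum>s<4. (-\<i>) ^ s * ?c s)"
        by (simp add: norm_mult norm_power)
      also have "\<dots> \<le> 2 * real d ^ 2 * (\<Sum>s<4. cmod ((-\<i>) ^ s * ?c s))"
        by (intro mult_left_mono norm_sum) simp
      also have "(\<Sum>s<4. cmod ((-\<i>) ^ s * ?c s)) = (\<Sum>s<4. ?g (fst p, snd p, s) x)"
        by (simp add: norm_mult norm_power case_prod_unfold)
      finally show ?thesis .
    qed
    then have "L2_set (\<lambda>x. cmod (f (fst x * d + fst p) (snd x * d + snd p))) ?J
      \<le> L2_set (\<lambda>x. 2 * real d ^ 2 * (\<Sum>s<4. ?g (fst p, snd p, s) x)) ?J"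
      by (intro L2_set_mono) simp_all
    also have "\<dots> = 2 * real d ^ 2 * L2_set (\<lambda>x. \<Sum>s<4. ?g (fst p, snd p, s) x) ?J"
      by (rule L2_set_right_distrib[symmetric]) simp
    also have "\<dots> \<le> 2 * real d ^ 2 * (\<Sum>s<4. L2_set (?g (fst p, snd p, s)) ?J)"
      by (intro mult_left_mono L2_set_sum) simp
    finally show "L2_set (\<lambda>x. cmod (f (fst x * d + fst p) (snd x * d + snd p))) ?J
      \<le> 2 * real d ^ 2 * (\<Sum>s<4. L2_set (?g (fst p, snd p, s)) ?J)" .
  qed
  also have "\<dots> = 2 * real d ^ 2 * (\<Sum>z\<in>settings d. L2_set (?g z) ?J)"
    unfolding settings_def sum_distrib_left[symmetric]
    by (simp only: sum.cartesian_product' fst_conv snd_conv)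
  finally show ?thesis .
qed

lemma pos_form_identity: "pos_form d (\<lambda>b b'. of_bool (b = b'))"
  unfolding pos_form_def
proof
  fix u
  have "contract d u (\<lambda>b b'. of_bool (b = b')) = (\<Sum>b<d. \<Sum>b'<d. of_bool (b' = b) * (u b' * cnj (u b)))"
    unfolding contract_def by (intro sum.cong refl) auto
  also have "\<dots> = (\<Sum>b<d. u b * cnj (u b))"
    by (intro sum.cong refl sum_of_bool_mult) auto
  finally show "0 \<le> contract d u (\<lambda>b b'. of_bool (b = b'))"
    by (simp only: sum_nonneg mult_cnj_nonneg)
qed

section \<open>The one-way measurement and its error\<close>

context povm_extension
begin

text \<open>For records of weight zero any POVM will do.\<close>

definition receiver_effect :: "((nat \<times> nat \<times> nat) \<times> 'y) list \<Rightarrow> 'y \<Rightarrow> nat \<Rightarrow> nat \<Rightarrow> complex" where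
  "receiver_effect l y b b' = (if outcome_weight l = 0 then of_real (1 / real (card (UNIV :: 'y set))) * of_bool (b = b')
     else of_real (1 / outcome_weight l) * (\<Sum>a<n. joint_marginal y l (a * d + b) (a * d + b')))"

lemma hilbert_schmidt_le_weight: "length l \<le> Suc r \<Longrightarrow> L2_set (\<lambda>(a,a'). cmod (outcome_marginal l a a')) ({..<n} \<times> {..<n}) \<le> outcome_weight l"
  unfolding outcome_weight_def by (rule pos_form_hilbert_schmidt_le_trace[OF outcome_marginal_pos])

lemma outcome_weight_nonneg: "length l \<le> Suc r \<Longrightarrow> outcome_weight l \<ge> 0"
  using hilbert_schmidt_le_weight[of l] L2_set_nonneg order_trans by blast

lemma receiver_effect_pos: "length l \<le> r \<Longrightarrow> pos_form d (receiver_effect l y)"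
proof (cases "outcome_weight l = 0")
  case True
  then have "receiver_effect l y = (\<lambda>b b'. of_real (1 / real (card (UNIV :: 'y set))) * of_bool (b = b'))"
    by (intro ext) (simp add: receiver_effect_def)
  then show ?thesis by (simp only:) (intro pos_form_scale pos_form_identity, simp)
next
  case False
  assume l: "length l \<le> r"
  have "0 \<le> outcome_weight l" using outcome_weight_nonneg l by simp
  then show ?thesis using False joint_marginal_pos[OF l] unfolding receiver_effect_def
    by (simp only: if_False) (intro pos_form_scale pos_form_sum, simp, intro pos_form_block[where m = n], auto)
qed

text \<open>Condition (ii) makes the effects conditioned on \<open>l\<close> sum to the identity
  after division by the weight of \<open>l\<close>.\<close>

lemma sum_receiver_effect:
  assumes "length l \<le> r" "b < d" "b' < d"
  shows "(\<Sum>y\<in>UNIV. receiver_effect l y b b') = of_bool (b = b')"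
proof (cases "outcome_weight l = 0")
  case False
  then have "(\<Sum>y\<in>UNIV. receiver_effect l y b b') = of_real (1 / outcome_weight l) * (\<Sum>y\<in>UNIV. \<Sum>a<n. joint_marginal y l (a * d + b) (a * d + b'))"
    by (simp only: receiver_effect_def if_False sum_distrib_left)
  then show ?thesis unfolding joint_marginal_no_signalling[OF assms] using False by simp
qed (simp add: receiver_effect_def)

text \<open>Probing the deviation from a product gives exactly the martingale increment, since the
  probed \<open>receiver_effect\<close> is the conditional probability of the record
  \<open>(z,y)\<close> given \<open>l\<close>. At weight zero \<open>outcome_marginal l\<close>
  vanishes, so the default effect is harmless.\<close>

lemma contract_product_error:
  assumes l: "length l \<le> r" and a: "a < n" "a' < n"
  shows "contract d (probe d z) (\<lambda>b b'. joint_marginal y l (a * d + b) (a' * d + b') - outcome_marginal l a a' * receiver_effect l y b b')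
    = outcome_marginal ((z,y) # l) a a' - of_real (outcome_weight ((z,y) # l) / outcome_weight l) * outcome_marginal l a a'"
proof -
  have "contract d (probe d z) (\<lambda>b b'. joint_marginal y l (a * d + b) (a' * d + b') - outcome_marginal l a a' * receiver_effect l y b b')
    = outcome_marginal ((z,y) # l) a a' - outcome_marginal l a a' * contract d (probe d z) (receiver_effect l y)"
    unfolding contract_diff contract_scale outcome_marginal_Cons[OF l] by simp
  moreover have "outcome_marginal l a a' * contract d (probe d z) (receiver_effect l y) = of_real (outcome_weight ((z,y) # l) / outcome_weight l) * outcome_marginal l a a'"
  proof (cases "outcome_weight l = 0")
    case True
    then have "L2_set (\<lambda>(a,a'). cmod (outcome_marginal l a a')) ({..<n} \<times> {..<n}) = 0"
      using hilbert_schmidt_le_weight[of l] l by (intro antisym) auto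
    then have "outcome_marginal l a a' = 0" using a by (auto simp: L2_set_eq_0_iff)
    then show ?thesis by simp
  next
    case False
    have "contract d (probe d z) (receiver_effect l y) = of_real (1 / outcome_weight l) *
        (\<Sum>a<n. contract d (probe d z) (\<lambda>b b'. joint_marginal y l (a * d + b) (a * d + b')))"
      using False unfolding receiver_effect_def by (simp only: if_False contract_scale contract_sum)
    also have "\<dots> = of_real (1 / outcome_weight l) * of_real (outcome_weight ((z,y) # l))"
      using trace_outcome_marginal[of "(z,y) # l"] l by (simp add: outcome_marginal_Cons[OF l])
    finally show ?thesis by simp
  qed
  ultimately show ?thesis by simp
qed

text \<open>There are \<open>Suc r\<close> steps, one for each system; a level
  \<open>m \<le> r\<close> leaves one system outside the record to play the role of
  \<open>B\<close>. The initial weight \<open>n\<close> is the trace of the identity on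
  \<open>A\<close>.\<close>

lemma exists_good_level:
  "\<exists>m\<le>r. (\<Sum>l\<in>words records m. \<Sum>s\<in>records. L2_set (\<lambda>(a,a').
     cmod (outcome_marginal (s # l) a a' - of_real (outcome_weight (s # l) / outcome_weight l) * outcome_marginal l a a')) ({..<n} \<times> {..<n})) \<le> real n / sqrt (real (Suc r))"
proof -
  have "outcome_weight [] = real n"
    using sum_outcome_marginal[of 0] by (simp add: outcome_weight_def)
  moreover have "\<exists>m<Suc r. (\<Sum>l\<in>words records m. \<Sum>s\<in>records. L2_set (\<lambda>j.
     cmod (case_prod (outcome_marginal (s # l)) j - of_real (outcome_weight (s # l) / outcome_weight l) * case_prod (outcome_marginal l) j)) ({..<n} \<times> {..<n}))
     \<le> outcome_weight [] / sqrt (real (Suc r))"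
  proof (rule exists_small_increment)
    fix m l j assume m: "m < Suc r" and l: "l \<in> words records m"
    then have len: "length l \<le> r" by (simp add: words_def)
    show "(\<Sum>s\<in>records. case_prod (outcome_marginal (s # l)) j) = case_prod (outcome_marginal l) j" if "j \<in> {..<n} \<times> {..<n}"
      using that sum_outcome_marginal_Cons[OF len] by auto
    have "(\<Sum>s\<in>records. outcome_weight (s # l)) = Re (\<Sum>a<n. \<Sum>s\<in>records. outcome_marginal (s # l) a a)"
      unfolding outcome_weight_def Re_sum[symmetric] by (subst sum.swap) (rule refl)
    then show "(\<Sum>s\<in>records. outcome_weight (s # l)) = outcome_weight l"
      using sum_outcome_marginal_Cons[OF len] by (simp add: outcome_weight_def)
  next
    fix m l assume "m \<le> Suc r" "l \<in> words records m"
    then show "L2_set (\<lambda>j. cmod (case_prod (outcome_marginal l) j)) ({..<n} \<times> {..<n}) \<le> outcome_weight l"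
      using hilbert_schmidt_le_weight[of l] by (simp add: words_def case_prod_unfold)
  qed auto
  ultimately show ?thesis by (auto simp: case_prod_unfold less_Suc_eq_le)
qed

theorem one_WL_approximation:
  "\<exists>\<Lambda> :: 'y \<Rightarrow> complex mat. is_povm (n * d) UNIV \<Lambda> \<and> one_WL n d \<Lambda> \<and>
     (\<forall>y. trace_norm (P y - \<Lambda> y) \<le> sqrt (real (n * d)) * (2 * real d ^ 2 * (real n / sqrt (real (Suc r)))))"
proof -
  obtain m where m: "m \<le> r" and small: "(\<Sum>l\<in>words records m. \<Sum>s\<in>records. L2_set (\<lambda>(a,a').
     cmod (outcome_marginal (s # l) a a' - of_real (outcome_weight (s # l) / outcome_weight l) * outcome_marginal l a a')) ({..<n} \<times> {..<n})) \<le> real n / sqrt (real (Suc r))"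
    using exists_good_level by blast
  have len: "length l \<le> r" if "l \<in> words records m" for l using that m by (simp add: words_def)
  \<comment> \<open>\<open>one_WL\<close> asks for natural numbers as messages, so the records at
    level \<open>m\<close> are enumerated.\<close>
  define X where "X = {..<card (words records m)}"
  obtain \<phi> where \<phi>: "bij_betw \<phi> X (words records m)"
    using ex_bij_betw_nat_finite[of "words records m"] by (auto simp: X_def atLeast0LessThan)
  have \<phi>X: "\<phi> x \<in> words records m" if "x \<in> X" for x using \<phi> that by (auto simp: bij_betw_def)
  define E where "E x = mat n n (\<lambda>(a,a'). outcome_marginal (\<phi> x) a a')" for x
  define Fm where "Fm x y = mat d d (\<lambda>(b,b'). receiver_effect (\<phi> x) y b b')" for x y
  define \<Lambda> where "\<Lambda> y = msum (n * d) X (\<lambda>x. kron (E x) (Fm x y))" for y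
  have E_povm: "is_povm n X E"
    unfolding is_povm_def
  proof (intro conjI ballI)
    fix x assume "x \<in> X"
    then show "psd n (E x)"
      unfolding psd_iff_pos_form using outcome_marginal_pos[OF le_SucI[OF len[OF \<phi>X]]] pos_form_cong[of n "\<lambda>i j. E x $$ (i,j)" "outcome_marginal (\<phi> x)"]
      by (auto simp: E_def)
  next
    show "msum n X E = 1\<^sub>m n"
    proof (rule eq_matI)
      fix i j assume "i < dim_row (1\<^sub>m n)" "j < dim_col (1\<^sub>m n)"
      then have ij: "i < n" "j < n" by auto
      have "msum n X E $$ (i,j) = (\<Sum>x\<in>X. outcome_marginal (\<phi> x) i j)"
        using ij by (simp add: msum_entry E_def)
      also have "\<dots> = (\<Sum>l\<in>words records m. outcome_marginal l i j)" by (rule sum.reindex_bij_betw[OF \<phi>])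
      finally show "msum n X E $$ (i,j) = 1\<^sub>m n $$ (i,j)" using ij by (simp add: sum_outcome_marginal[OF m])
    qed (auto simp: msum_def)
  qed (simp add: X_def)
  have F_povm: "is_povm d UNIV (Fm x)" if x: "x \<in> X" for x
    unfolding is_povm_def
  proof (intro conjI ballI)
    fix y
    show "psd d (Fm x y)"
      unfolding psd_iff_pos_form using receiver_effect_pos[OF len[OF \<phi>X[OF x]], of y]
        pos_form_cong[of d "\<lambda>i j. Fm x y $$ (i,j)" "receiver_effect (\<phi> x) y"]
      by (auto simp: Fm_def)
  next
    show "msum d UNIV (Fm x) = 1\<^sub>m d"
      by (rule eq_matI) (auto simp: msum_def Fm_def sum_receiver_effect[OF len[OF \<phi>X[OF x]]])
  qed simp
  have \<Lambda>_entry: "\<Lambda> y $$ (i,j) = (\<Sum>l\<in>words records m. outcome_marginal l (i div d) (j div d) * receiver_effect l y (i mod d) (j mod d))"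
    if ij: "i < n * d" "j < n * d" for y i j
  proof -
    have "\<Lambda> y $$ (i,j) = (\<Sum>x\<in>X. outcome_marginal (\<phi> x) (i div d) (j div d) * receiver_effect (\<phi> x) y (i mod d) (j mod d))"
      using ij d by (simp add: \<Lambda>_def msum_entry kron_def E_def Fm_def less_mult_imp_div_less)
    also have "\<dots> = (\<Sum>l\<in>words records m. outcome_marginal l (i div d) (j div d) * receiver_effect l y (i mod d) (j mod d))"
      by (rule sum.reindex_bij_betw[OF \<phi>])
    finally show ?thesis .
  qed
  have \<Lambda>_carrier: "\<Lambda> y \<in> carrier_mat (n * d) (n * d)" for y by (simp add: \<Lambda>_def msum_def)
  have \<Lambda>_povm: "is_povm (n * d) UNIV \<Lambda>"
    unfolding is_povm_def
  proof (intro conjI ballI)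
    fix y
    have "pos_form (n * d) (\<lambda>i j. \<Sum>l\<in>words records m. outcome_marginal l (i div d) (j div d) * receiver_effect l y (i mod d) (j mod d))"
      by (intro pos_form_sum pos_form_tensor outcome_marginal_pos receiver_effect_pos) (auto dest: len)
    moreover have "pos_form (n * d) (\<lambda>i j. \<Lambda> y $$ (i,j))
      = pos_form (n * d) (\<lambda>i j. \<Sum>l\<in>words records m. outcome_marginal l (i div d) (j div d) * receiver_effect l y (i mod d) (j mod d))"
      by (rule pos_form_cong) (rule \<Lambda>_entry)
    ultimately show "psd (n * d) (\<Lambda> y)"
      unfolding psd_iff_pos_form using \<Lambda>_carrier[of y] by blast
  next
    show "msum (n * d) UNIV \<Lambda> = 1\<^sub>m (n * d)"
    proof (rule eq_matI)
      fix i j assume "i < dim_row (1\<^sub>m (n * d))" "j < dim_col (1\<^sub>m (n * d))"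
      then have ij: "i < n * d" "j < n * d" by auto
      then have lt: "i div d < n" "j div d < n" "i mod d < d" "j mod d < d"
        using d by (auto simp: less_mult_imp_div_less)
      have "msum (n * d) UNIV \<Lambda> $$ (i,j)
        = (\<Sum>l\<in>words records m. outcome_marginal l (i div d) (j div d) * (\<Sum>y\<in>UNIV. receiver_effect l y (i mod d) (j mod d)))"
        using ij by (simp add: msum_entry \<Lambda>_entry sum_distrib_left) (rule sum.swap)
      also have "\<dots> = of_bool (i div d = j div d) * of_bool (i mod d = j mod d)"
        using lt by (simp add: sum_receiver_effect len sum_distrib_right[symmetric] sum_outcome_marginal[OF m])
      also have "\<dots> = of_bool (i = j)"
      proof -
        have "(i div d = j div d \<and> i mod d = j mod d) = (i = j)" by (metis div_mult_mod_eq)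
        then show ?thesis by (simp only: of_bool_conj[symmetric])
      qed
      finally show "msum (n * d) UNIV \<Lambda> $$ (i,j) = 1\<^sub>m (n * d) $$ (i,j)" using ij by simp
    qed (auto simp: msum_def)
  qed simp
  have "one_WL n d \<Lambda>"
    unfolding one_WL_def using E_povm F_povm \<Lambda>_def by blast
  moreover have "trace_norm (P y - \<Lambda> y) \<le> sqrt (real (n * d)) * (2 * real d ^ 2 * (real n / sqrt (real (Suc r))))" for y
  proof -
    let ?J = "{..<n} \<times> {..<n}" and ?I = "{..<n * d} \<times> {..<n * d}"
    \<comment> \<open>The error at a single record: joint operator minus product. Summed over the
      records it gives \<open>P y - \<Lambda> y\<close>.\<close>
    define D where "D l i j = joint_marginal y l i j - outcome_marginal l (i div d) (j div d) * receiver_effect l y (i mod d) (j mod d)" for l i j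
    have entry: "(P y - \<Lambda> y) $$ (i,j) = (\<Sum>l\<in>words records m. D l i j)" if "i < n * d" "j < n * d" for i j
      using that \<Lambda>_carrier[of y] P_carrier[of y]
      by (simp add: \<Lambda>_entry sum_joint_marginal[OF m] D_def sum_subtractf)
    have "L2_set (\<lambda>(i,j). cmod ((P y - \<Lambda> y) $$ (i,j))) ?I
      \<le> L2_set (\<lambda>x. \<Sum>l\<in>words records m. cmod (D l (fst x) (snd x))) ?I"
      by (intro L2_set_mono) (auto simp: entry simp del: index_minus_mat intro: norm_sum)
    also have "\<dots> \<le> (\<Sum>l\<in>words records m. L2_set (\<lambda>x. cmod (D l (fst x) (snd x))) ?I)"
      by (rule L2_set_sum)
    also have "\<dots> \<le> (\<Sum>l\<in>words records m. 2 * real d ^ 2 * (\<Sum>z\<in>settings d. L2_set (\<lambda>(a,a').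
        cmod (outcome_marginal ((z,y) # l) a a' - of_real (outcome_weight ((z,y) # l) / outcome_weight l) * outcome_marginal l a a')) ?J))"
    proof (rule sum_mono)
      fix l assume l: "l \<in> words records m"
      have eq: "contract d (probe d z) (\<lambda>b b'. D l (a * d + b) (a' * d + b'))
        = outcome_marginal ((z,y) # l) a a' - of_real (outcome_weight ((z,y) # l) / outcome_weight l) * outcome_marginal l a a'" if "a < n" "a' < n" for z a a'
      proof -
        have "contract d (probe d z) (\<lambda>b b'. D l (a * d + b) (a' * d + b'))
          = contract d (probe d z) (\<lambda>b b'. joint_marginal y l (a * d + b) (a' * d + b') - outcome_marginal l a a' * receiver_effect l y b b')"
          by (rule contract_cong) (simp add: D_def div_index)
        then show ?thesis using contract_product_error[OF len[OF l] that] by simp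
      qed
      have "L2_set (\<lambda>x. cmod (D l (fst x) (snd x))) ?I \<le> 2 * real d ^ 2 * (\<Sum>z\<in>settings d. L2_set (\<lambda>(a,a').
        cmod (contract d (probe d z) (\<lambda>b b'. D l (a * d + b) (a' * d + b')))) ?J)"
        using hilbert_schmidt_le_tomography[of "D l" n d] by (simp add: case_prod_unfold)
      also have "\<dots> = 2 * real d ^ 2 * (\<Sum>z\<in>settings d. L2_set (\<lambda>(a,a').
        cmod (outcome_marginal ((z,y) # l) a a' - of_real (outcome_weight ((z,y) # l) / outcome_weight l) * outcome_marginal l a a')) ?J)"
        by (intro arg_cong2[where f = "(*)"] refl sum.cong L2_set_cong) (auto simp: eq)
      finally show "L2_set (\<lambda>x. cmod (D l (fst x) (snd x))) ?I \<le> 2 * real d ^ 2 * (\<Sum>z\<in>settings d. L2_set (\<lambda>(a,a').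
        cmod (outcome_marginal ((z,y) # l) a a' - of_real (outcome_weight ((z,y) # l) / outcome_weight l) * outcome_marginal l a a')) ?J)" .
    qed
    \<comment> \<open>For fixed \<open>y\<close> only the records \<open>(z,y)\<close> occur;
      enlarging to all records reaches the sum bounded in \<open>exists_good_level\<close>.\<close>
    also have "\<dots> \<le> 2 * real d ^ 2 * (\<Sum>l\<in>words records m. \<Sum>s\<in>records. L2_set (\<lambda>(a,a').
        cmod (outcome_marginal (s # l) a a' - of_real (outcome_weight (s # l) / outcome_weight l) * outcome_marginal l a a')) ?J)"
      unfolding sum_distrib_left[symmetric]
    proof (intro mult_left_mono sum_mono)
      fix l
      let ?g = "\<lambda>s. L2_set (\<lambda>(a,a'). cmod (outcome_marginal (s # l) a a' - of_real (outcome_weight (s # l) / outcome_weight l) * outcome_marginal l a a')) ?J"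
      have "(\<Sum>z\<in>settings d. ?g (z,y)) = (\<Sum>s\<in>(\<lambda>z. (z,y)) ` settings d. ?g s)"
        by (subst sum.reindex) (auto simp: inj_on_def)
      also have "\<dots> \<le> (\<Sum>s\<in>records. ?g s)" by (rule sum_mono2) auto
      finally show "(\<Sum>z\<in>settings d. ?g (z,y)) \<le> (\<Sum>s\<in>records. ?g s)" .
    qed simp
    also have "\<dots> \<le> 2 * real d ^ 2 * (real n / sqrt (real (Suc r)))"
      by (intro mult_left_mono small) simp
    finally have "L2_set (\<lambda>(i,j). cmod ((P y - \<Lambda> y) $$ (i,j))) ?I \<le> 2 * real d ^ 2 * (real n / sqrt (real (Suc r)))" .
    then show ?thesis
      using trace_norm_le_hilbert_schmidt[of "P y - \<Lambda> y" "n * d"] \<Lambda>_carrier[of y] P_carrier[of y]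
      by (meson minus_carrier_mat mult_left_mono order_trans real_sqrt_ge_zero of_nat_0_le_iff)
  qed
  ultimately show ?thesis using \<Lambda>_povm by blast
qed

end

text \<open>The construction gives \<open>2 |B|^(5/2) |A|^(3/2) / sqrt k\<close>. It is compared
  with the stated bound in two factors, one in \<open>|B|\<close> and \<open>|Y|\<close>, the other
  in \<open>|A|\<close> and \<open>k\<close>.\<close>

theorem theorem2:
  fixes dA dB k :: nat and P :: "'y::finite \<Rightarrow> complex mat"
  assumes "dA \<ge> 1" and "dB \<ge> 1" and "k \<ge> 2"
    and "is_povm (dA * dB) UNIV P"
    and "k_extendible dA dB k P"
  shows "\<exists>\<Lambda> :: 'y \<Rightarrow> complex mat. is_povm (dA * dB) UNIV \<Lambda> \<and> one_WL dA dB \<Lambda> \<and>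
     (\<forall>y. trace_norm (P y - \<Lambda> y) \<le>
        real dB ^ 3 * real (card (UNIV :: 'y set)) ^ 2 * (real dB * real (card (UNIV :: 'y set)) + 1)
          * sqrt (2 * ln 2 * real dA ^ 3 / real k))"
proof -
  obtain r where k: "k = Suc r" using assms(3) by (cases k) auto
  from assms(5) obtain G :: "'y list \<Rightarrow> complex mat" where "povm_extension dA dB r P G"
    unfolding k_extendible_def k povm_extension_def using assms(2,4) by auto
  then interpret povm_extension dA dB r P G .
  let ?c = "real (card (UNIV :: 'y set))"
  have c: "?c \<ge> 1" by (simp add: Suc_leI card_gt_0_iff)
  have B: "real dB \<ge> 1" using assms(2) by simp
  \<comment> \<open>The bound \<open>ln x \<le> x - 1\<close> at \<open>x = 1/2\<close> gives
    \<open>2 * ln 2 \<ge> 1\<close>, which inserts this constant under the root.\<close>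
  have "ln (1 / 2 :: real) \<le> 1 / 2 - 1" by (rule ln_le_minus_one) simp
  then have ln2: "2 * ln 2 \<ge> (1::real)" by (simp add: ln_div)
  have "sqrt (real (dA * dB)) * (2 * real dB ^ 2 * (real dA / sqrt (real k)))
    = (2 * sqrt (real dB) * real dB ^ 2) * (sqrt (real dA) * real dA / sqrt (real k))"
    by (simp add: real_sqrt_mult)
  also have "sqrt (real dA) * real dA = sqrt (real dA ^ 3)"
    by (simp add: power3_eq_cube real_sqrt_mult)
  also have "sqrt (real dA ^ 3) / sqrt (real k) = sqrt (1 * real dA ^ 3 / real k)"
    by (simp add: real_sqrt_divide)
  also have "2 * sqrt (real dB) * real dB ^ 2 * sqrt (1 * real dA ^ 3 / real k)
    \<le> real dB ^ 3 * ?c ^ 2 * (real dB * ?c + 1) * sqrt (2 * ln 2 * real dA ^ 3 / real k)"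
  proof (rule mult_mono)
    have "sqrt (real dB) \<le> real dB"
      using B by (intro real_le_lsqrt) (auto simp: power2_eq_square)
    then have "2 * sqrt (real dB) * real dB ^ 2 \<le> 2 * real dB ^ 3"
      by (simp add: power3_eq_cube power2_eq_square mult_right_mono mult.assoc)
    also have "\<dots> \<le> (real dB ^ 3 * ?c ^ 2) * (real dB * ?c + 1)"
    proof -
      have "1 \<le> real dB * ?c" using B c by (metis mult_mono' mult_1 zero_le_one)
      moreover have "1 \<le> ?c ^ 2" using c by (rule one_le_power)
      ultimately have "(real dB ^ 3 * 1) * (1 + 1) \<le> (real dB ^ 3 * ?c ^ 2) * (real dB * ?c + 1)"
        by (intro mult_mono) auto
      then show ?thesis by simp
    qed
    finally show "2 * sqrt (real dB) * real dB ^ 2 \<le> real dB ^ 3 * ?c ^ 2 * (real dB * ?c + 1)" .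
    show "sqrt (1 * real dA ^ 3 / real k) \<le> sqrt (2 * ln 2 * real dA ^ 3 / real k)"
      using ln2 by (intro real_sqrt_le_mono divide_right_mono mult_right_mono) auto
  qed auto
  finally show ?thesis
    using one_WL_approximation unfolding k by (meson order_trans)
qed

end
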